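(* Let $R\in(0,\infty)$, let $N\ge2$ and $k\ge1$ be integers and $p\ge1$ real. Let $\phi$ be a nonnegative smooth function on $[0,R)$, positive on $(0,R)$, with $\phi'(0)=1$ and $\phi^{(i)}(0)=0$ for all even $i\ge0$, and assume that $$0<\liminf_{r\to R}\phi(r)\le\limsup_{r\to R}\phi(r)<\infty.$$ If $N>kp$, then there exists $C>0$ such that for all $v\in W^{k,p}((0,R),\phi^{N-1})$, $$|v(t)|\le C\,\frac{1}{\phi(t)^{\frac{N-kp}{p}}}\,\|v\|_{W^{k,p}_{\phi^{N-1}}},\qquad\forall t\in(0,R).$$
   Context: $W^{k,p}((0,R),\phi^{N-1})$ is the space of $v\colon(0,R)\to\mathbb R$ having $k$ weak derivatives with $\int_0^R|v^{(j)}(t)|^p\phi^{N-1}(t)\,\mathrm dt<\infty$ for all $j=0,\ldots,k$, with norm $\|v\|_{W^{k,p}_{\phi^{N-1}}}=\big(\sum_{j=0}^k\int_0^R|v^{(j)}(t)|^p\phi^{N-1}(t)\,\mathrm dt\big)^{1/p}$. Each $v$ in this space is identified with its continuous representative. *)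

theory Defs
  imports "HOL-Analysis.Analysis"
begin

text \<open>
  Derivatives are taken within \<open>S\<close>, hence they are one-sided at an endpoint of an interval
  that belongs to \<open>S\<close> (such as \<open>0\<close> for \<open>S = {0..<R}\<close>).
\<close>

fun iter_deriv_on :: "real set \<Rightarrow> nat \<Rightarrow> (real \<Rightarrow> real) \<Rightarrow> real \<Rightarrow> real" where
  "iter_deriv_on S 0 f = f"
| "iter_deriv_on S (Suc n) f = (\<lambda>x. vector_derivative (iter_deriv_on S n f) (at x within S))"

definition smooth_on :: "real set \<Rightarrow> (real \<Rightarrow> real) \<Rightarrow> bool" where
  "smooth_on S f \<longleftrightarrow> (\<forall>n. iter_deriv_on S n f differentiable_on S)"

definition test_functions :: "real \<Rightarrow> (real \<Rightarrow> real) set" where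
  "test_functions R = {\<psi>. smooth_on UNIV \<psi> \<and>
     compact (closure {x. \<psi> x \<noteq> 0}) \<and> closure {x. \<psi> x \<noteq> 0} \<subseteq> {0<..<R}}"

definition locally_integrable :: "real \<Rightarrow> (real \<Rightarrow> real) \<Rightarrow> bool" where
  "locally_integrable R v \<longleftrightarrow>
     (\<forall>K. compact K \<and> K \<subseteq> {0<..<R} \<longrightarrow> set_integrable lebesgue K v)"

text \<open>\<open>g\<close> is a \<open>j\<close>-th weak derivative of \<open>v\<close> on \<open>(0,R)\<close>; values outside \<open>(0,R)\<close> are irrelevant.\<close>

definition has_weak_deriv :: "real \<Rightarrow> nat \<Rightarrow> (real \<Rightarrow> real) \<Rightarrow> (real \<Rightarrow> real) \<Rightarrow> bool" where
  "has_weak_deriv R j v g \<longleftrightarrow> locally_integrable R v \<and> locally_integrable R g \<and>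
     (\<forall>\<psi>\<in>test_functions R.
        (LINT t:{0<..<R}|lebesgue. v t * iter_deriv_on UNIV j \<psi> t) =
        (-1) ^ j * (LINT t:{0<..<R}|lebesgue. g t * \<psi> t))"

text \<open>
  Weak derivatives are unique only up to null sets; \<open>weak_deriv\<close> picks one of them, so it may
  only be used where null sets do not matter.
\<close>

definition weak_deriv :: "real \<Rightarrow> nat \<Rightarrow> (real \<Rightarrow> real) \<Rightarrow> real \<Rightarrow> real" where
  "weak_deriv R j v = (SOME g. has_weak_deriv R j v g)"

definition weighted_sobolev ::
    "nat \<Rightarrow> real \<Rightarrow> real \<Rightarrow> (real \<Rightarrow> real) \<Rightarrow> (real \<Rightarrow> real) set" where
  "weighted_sobolev k p R w = {v. \<forall>j\<le>k. (\<exists>g. has_weak_deriv R j v g) \<and>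
     set_integrable lebesgue {0<..<R} (\<lambda>t. \<bar>weak_deriv R j v t\<bar> powr p * w t)}"

definition weighted_sobolev_norm ::
    "nat \<Rightarrow> real \<Rightarrow> real \<Rightarrow> (real \<Rightarrow> real) \<Rightarrow> (real \<Rightarrow> real) \<Rightarrow> real" where
  "weighted_sobolev_norm k p R w v =
     (\<Sum>j\<le>k. LINT t:{0<..<R}|lebesgue. \<bar>weak_deriv R j v t\<bar> powr p * w t) powr (1 / p)"

text \<open>
  The continuous representative of \<open>v\<close>. On \<open>(0,R)\<close> it is unique if it exists; if there is none,
  the value of \<open>cont_rep\<close> is arbitrary.
\<close>

definition cont_rep :: "real \<Rightarrow> (real \<Rightarrow> real) \<Rightarrow> real \<Rightarrow> real" where
  "cont_rep R v = (SOME u. continuous_on {0<..<R} u \<and>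
     (AE t in lebesgue. t \<in> {0<..<R} \<longrightarrow> u t = v t))"

end

(*
By the boundary conditions phi is comparable to t on (0,R). Write n = N / p. Testing the weak
derivative with smoothed indicators h(m(t-a)) - h(m(t-b)) and letting m tend to infinity at
Lebesgue points gives v(b) - v(a) = int_a^b v'. For the top derivative g, splitting according to
the size of |g| gives |g| <= mu + |g|^p mu^(1-p) with mu = A t^(-n), which replaces Hoelder's
inequality and yields int_a^R |g| <= C A a^(1-n) for every A exceeding the norm. Together with one
point of (R/2,R) where the derivative of next lower order is at most C A, this bounds the latter by
C A t^(1-n). Integrating this bound repeatedly (the exponents stay below -1 since N > k p) gives
|v| <= C A t^(k-n).
*)
theory Submission
  imports Defs "HOL-Computational_Algebra.Polynomial"
begin

section \<open>Smooth functions of compact support\<close>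

text \<open>Weak derivatives are picked by choice and known only up to null sets, so every pointwise
  statement is first made off a negligible set; continuity enters only at the end, for v itself. The
  kernels that detect Lebesgue points have to be genuine test functions, hence the explicit smooth
  step. No boundary condition holds at R, so integration cannot start there. The norm over (R/2,R),
  where the weight is bounded below, supplies a starting point instead. The threshold mu is the
  scale at which both terms of the splitting have tails of the same order a^(1-n), and the splitting
  treats p = 1 together with p > 1. It involves A^(1-p), so A has to be positive although the norm
  may vanish; A decreases to the norm only in the last step.\<close>

lemma iter_deriv_on_UNIV_mem:
  assumes closed: "\<And>f. f \<in> F \<Longrightarrow> \<exists>g\<in>F. \<forall>x. (f has_real_derivative g x) (at x)"
    and "f \<in> F"
  shows "iter_deriv_on UNIV n f \<in> F"
proof (induction n)
  case 0
  then show ?case using assms(2) by simp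
next
  case (Suc n)
  obtain g where "g \<in> F"
    and g: "\<forall>x. (iter_deriv_on UNIV n f has_real_derivative g x) (at x)"
    using closed[OF Suc] by auto
  have "iter_deriv_on UNIV (Suc n) f = g"
    using g
    by (auto simp: fun_eq_iff has_real_derivative_iff_has_vector_derivative
        intro!: vector_derivative_at)
  then show ?case using \<open>g \<in> F\<close> by simp
qed

text \<open>A family containing a derivative of each member contains all iterated derivatives, so
  smoothness is certified without any formula for the n-th derivative.\<close>

lemma smooth_on_UNIV_if_deriv_closed:
  assumes closed: "\<And>f. f \<in> F \<Longrightarrow> \<exists>g\<in>F. \<forall>x. (f has_real_derivative g x) (at x)"
    and "f \<in> F"
  shows "smooth_on UNIV f"
  unfolding smooth_on_def differentiable_on_def
  using closed[OF iter_deriv_on_UNIV_mem[OF assms]]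
  by (meson UNIV_I has_field_derivative_imp_has_derivative differentiable_def)

text \<open>The classical bump function is \<open>bump 1 0\<close>. Polynomial factors and powers of
  1/(x (1 - x)) are exactly what differentiation produces, so the family is closed under it.\<close>

definition bump :: "real poly \<Rightarrow> nat \<Rightarrow> real \<Rightarrow> real" where
  "bump P m x = (if 0 < x \<and> x < 1
     then poly P x * inverse (x * (1 - x)) ^ m * exp (- inverse (x * (1 - x))) else 0)"

lemma power_div_fact_le_exp:
  fixes x :: real
  assumes "0 \<le> x"
  shows "x ^ n / fact n \<le> exp x"
proof -
  have "sum (\<lambda>n. x ^ n /\<^sub>R fact n) {n} \<le> (\<Sum>n. x ^ n /\<^sub>R fact n)"
    using assms exp_converges[of x] by (intro sum_le_suminf) (auto simp: sums_iff)
  also have "\<dots> = exp x" using exp_converges[of x] by (simp only: sums_iff)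
  finally have "sum (\<lambda>n. x ^ n /\<^sub>R fact n) {n} \<le> exp x" .
  then show ?thesis by (simp add: divide_inverse mult.commute)
qed

text \<open>exp(-1/s) decays faster than any power of s = y (1 - y), so it cancels the negative
  power and leaves a factor s^2. As \<open>bump P m\<close> vanishes at x, the quadratic bound
  forces derivative 0 there, the endpoints 0 and 1 included.\<close>

lemma bump_quadratic_bound:
  "\<exists>K. \<forall>x y. \<not> (0 < x \<and> x < 1) \<longrightarrow> \<bar>bump P m y\<bar> \<le> K * (y - x)\<^sup>2"
proof -
  have "compact (poly P ` {0..1})"
    by (intro compact_continuous_image continuous_intros compact_Icc)
  then obtain B where B: "\<And>x. 0 \<le> x \<Longrightarrow> x \<le> 1 \<Longrightarrow> \<bar>poly P x\<bar> \<le> B"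
    by (force dest!: compact_imp_bounded simp: bounded_iff)
  have B0: "0 \<le> B" using B[of 0] by auto
  \<comment> \<open>B bounds the polynomial on [0,1]; the factorial comes from exp(-1/s) \<le>
    (m+2)! s^(m+2), where m powers of s absorb the negative power and two remain.\<close>
  define K where "K = B * fact (m + 2)"
  have "\<bar>bump P m y\<bar> \<le> K * (y - x)\<^sup>2" if x: "\<not> (0 < x \<and> x < 1)" for x y
  proof (cases "0 < y \<and> y < 1")
    case True
    define s where "s = y * (1 - y)"
    have s: "0 < s" using True by (simp add: s_def)
    have e: "exp (- inverse s) \<le> fact (m + 2) * s ^ (m + 2)"
    proof -
      have "inverse (exp (inverse s)) \<le> inverse (inverse s ^ (m + 2) / fact (m + 2))"
        using s by (intro le_imp_inverse_le power_div_fact_le_exp) auto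
      then show ?thesis by (simp add: exp_minus divide_inverse power_inverse ac_simps)
    qed
    have "\<bar>bump P m y\<bar> = \<bar>poly P y\<bar> * inverse s ^ m * exp (- inverse s)"
      using True s by (simp add: bump_def s_def[symmetric] abs_mult)
    also have "\<dots> \<le> B * inverse s ^ m * (fact (m + 2) * s ^ (m + 2))"
      using B[of y] True s B0 e by (intro mult_mono) auto
    also have "\<dots> = K * s\<^sup>2"
      using s by (simp add: K_def power_add power2_eq_square field_simps)
    also have "\<dots> \<le> K * (y - x)\<^sup>2"
    proof -
      \<comment> \<open>The distance from y to a point outside (0,1) is at least the smaller of y
        and 1 - y, and y (1 - y) is below both.\<close>
      have "s \<le> \<bar>y - x\<bar>"
      proof (cases "x \<le> 0")
        case True' : True
        have "s \<le> y * 1" unfolding s_def using True by (intro mult_left_mono) auto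
        then show ?thesis using True' by linarith
      next
        case False
        have "s \<le> 1 * (1 - y)" unfolding s_def using True by (intro mult_right_mono) auto
        moreover have "1 \<le> x" using False x by linarith
        ultimately show ?thesis using True by (simp add: abs_if)
      qed
      then have "s\<^sup>2 \<le> (y - x)\<^sup>2" using s by (simp add: abs_le_square_iff[symmetric])
      then show ?thesis using B0 by (intro mult_left_mono) (auto simp: K_def)
    qed
    finally show ?thesis .
  next
    case False
    then have "bump P m y = 0" unfolding bump_def by (simp only: if_False)
    then show ?thesis using B0 by (simp add: K_def)
  qed
  then show ?thesis by blast
qed

lemma has_real_derivative_zero_if_quadratic:
  fixes f :: "real \<Rightarrow> real"
  assumes "\<And>y. \<bar>f y - f x\<bar> \<le> K * (y - x)\<^sup>2"
  shows "(f has_real_derivative 0) (at x)"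
proof -
  have "((\<lambda>y. (f y - f x) / (y - x)) \<longlongrightarrow> 0) (at x)"
  proof (rule Lim_null_comparison)
    show "\<forall>\<^sub>F y in at x. norm ((f y - f x) / (y - x)) \<le> K * \<bar>y - x\<bar>"
    proof (rule eventually_at_filter[THEN iffD2], rule always_eventually, intro allI impI)
      fix y assume "y \<noteq> x"
      then show "norm ((f y - f x) / (y - x)) \<le> K * \<bar>y - x\<bar>"
        using assms[of y] by (simp add: field_simps power2_eq_square abs_mult[symmetric])
    qed
    have "((\<lambda>y. K * \<bar>y - x\<bar>) \<longlongrightarrow> K * \<bar>x - x\<bar>) (at x)"
      by (intro tendsto_intros)
    then show "((\<lambda>y. K * \<bar>y - x\<bar>) \<longlongrightarrow> 0) (at x)" by simp
  qed
  then show ?thesis by (simp add: has_field_derivative_iff)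
qed

text \<open>Here \<open>[:0,1,-1:]\<close> is s = x (1 - x) and \<open>[:1,-2:]\<close> its
  derivative. The three terms come from differentiating the polynomial, the power (1/s)^m and the
  exponential; the factors s^2, s and 1 bring them over the common denominator s^(m+2).\<close>

lemma bump_has_derivative:
  "(bump P m has_real_derivative
     bump (pderiv P * [:0,1,-1:]\<^sup>2 - smult (real m) (P * [:1,-2:] * [:0,1,-1:]) + P * [:1,-2:]) (m + 2) x)
   (at x)"
proof (cases "0 < x \<and> x < 1")
  case True
  define s where "s = x * (1 - x)"
  have s: "s \<noteq> 0" using True by (simp add: s_def)
  have d: "((\<lambda>x. poly P x * inverse (x * (1 - x)) ^ m * exp (- inverse (x * (1 - x))))
     has_real_derivative 
      bump (pderiv P * [:0,1,-1:]\<^sup>2 - smult (real m) (P * [:1,-2:] * [:0,1,-1:]) + P * [:1,-2:]) (m + 2) x) (at x)"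
  proof -
    define i where "i = inverse s"
    have i: "s * i = 1" using s by (simp add: i_def)
    have ds: "((\<lambda>x. x * (1 - x)) has_real_derivative 1 - 2 * x) (at x)"
      by (auto intro!: derivative_eq_intros)
    have ii: "- (i * (1 - 2 * x) * i) = - ((1 - 2 * x) * inverse (s ^ Suc (Suc 0)))"
      by (simp add: i_def)
    from ds have d0: "((\<lambda>x. inverse (x * (1 - x))) has_real_derivative - (i * (1 - 2 * x) * i)) (at x)"
      using DERIV_inverse_fun[of "\<lambda>x. x * (1 - x)" "1 - 2 * x" x UNIV] s
      unfolding ii by (simp only: s_def simp_thms)
    have d1: "((\<lambda>x. inverse (x * (1 - x)) ^ m) has_real_derivative
        - (real m * (1 - 2 * x) * i ^ (m + 1))) (at x)"
      using DERIV_power[OF d0, of m]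
      by (cases m) (auto simp: s_def[symmetric] i_def[symmetric] mult_ac)
    have d2: "((\<lambda>x. exp (- inverse (x * (1 - x)))) has_real_derivative
        exp (- i) * (i * (1 - 2 * x) * i)) (at x)"
      using DERIV_fun_exp[OF DERIV_minus[OF d0]] by (simp add: s_def[symmetric] i_def)
    have i2: "s\<^sup>2 * i ^ (m + 2) = i ^ m" "s * i ^ (m + 2) = i ^ (m + 1)"
    proof -
      have "s\<^sup>2 * i ^ (m + 2) = (s * i)\<^sup>2 * i ^ m" "s * i ^ (m + 2) = (s * i) * i ^ (m + 1)"
        by (simp_all add: power_add power2_eq_square ac_simps)
      then show "s\<^sup>2 * i ^ (m + 2) = i ^ m" "s * i ^ (m + 2) = i ^ (m + 1)"
        unfolding i by simp_all
    qed
    have "bump (pderiv P * [:0,1,-1:]\<^sup>2 - smult (real m) (P * [:1,-2:] * [:0,1,-1:]) + P * [:1,-2:]) (m + 2) x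
      = (poly (pderiv P) x * s\<^sup>2 - real m * (poly P x * (1 - 2 * x) * s) + poly P x * (1 - 2 * x))
          * i ^ (m + 2) * exp (- i)"
      using True by (simp add: bump_def s_def[symmetric] i_def[symmetric] algebra_simps s_def i_def)
    also have "\<dots> = (poly (pderiv P) x * (s\<^sup>2 * i ^ (m + 2))
        - real m * (poly P x * (1 - 2 * x) * (s * i ^ (m + 2)))
        + poly P x * (1 - 2 * x) * i ^ (m + 2)) * exp (- i)"
      by (simp add: algebra_simps)
    finally have eq: "bump (pderiv P * [:0,1,-1:]\<^sup>2 - smult (real m) (P * [:1,-2:] * [:0,1,-1:]) + P * [:1,-2:]) (m + 2) x
      = (poly (pderiv P) x * i ^ m - real m * (poly P x * (1 - 2 * x) * i ^ (m + 1))
        + poly P x * (1 - 2 * x) * i ^ (m + 2)) * exp (- i)"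
      unfolding i2 .
    show ?thesis
      unfolding eq
      by (rule DERIV_cong[OF DERIV_mult[OF DERIV_mult[OF poly_DERIV[of P x] d1] d2]],
          unfold s_def[symmetric] i_def[symmetric]) (simp add: algebra_simps)
  qed
  show ?thesis
    by (rule has_field_derivative_transform_within_open[OF d, of "{0<..<1}"])
       (use True in \<open>auto simp: bump_def\<close>)
next
  case False
  obtain K where "\<And>y. \<bar>bump P m y\<bar> \<le> K * (y - x)\<^sup>2"
    using bump_quadratic_bound False by blast
  moreover have "bump Q n x = 0" for Q n using False unfolding bump_def by (simp only: if_False)
  ultimately show ?thesis
    by (auto intro!: has_real_derivative_zero_if_quadratic[where K = K])
qed


text \<open>The step is an antiderivative of the classical bump divided by its total mass, hence
  constant on either side of (0,1). \<open>F\<close> is handed on so that smoothness of rescaled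
  copies can be derived later.\<close>

lemma smooth_step_function_exists:
  obtains h \<rho> :: "real \<Rightarrow> real" and F M where
    "\<And>f. f \<in> F \<Longrightarrow> \<exists>g\<in>F. \<forall>x. (f has_real_derivative g x) (at x)"
    "h \<in> F" "\<rho> \<in> F"
    "\<And>x. (h has_real_derivative \<rho> x) (at x)"
    "\<And>x. x \<le> 0 \<Longrightarrow> h x = 0" "\<And>x. 1 \<le> x \<Longrightarrow> h x = 1"
    "\<And>x. 0 \<le> h x" "\<And>x. h x \<le> 1"
    "\<And>x. x \<le> 0 \<or> 1 \<le> x \<Longrightarrow> \<rho> x = 0"
    "\<And>x. 0 \<le> \<rho> x" "\<And>x. \<rho> x \<le> M"
proof -
  have bump_cont: "isCont (bump P m) x" for P m x
    using bump_has_derivative DERIV_isCont by blast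
  have "\<exists>G. \<forall>x. -\<infinity> < ereal x \<longrightarrow> ereal x < \<infinity> \<longrightarrow>
      (G has_vector_derivative bump 1 0 x) (at x)"
    by (rule einterval_antiderivative) (auto intro: bump_cont)
  then obtain G where G: "\<And>x. (G has_real_derivative bump 1 0 x) (at x)"
    by (auto simp: has_real_derivative_iff_has_vector_derivative)
  have nonneg: "0 \<le> bump 1 0 x" for x by (simp add: bump_def)
  have mono: "G x \<le> G y" if "x \<le> y" for x y
    using DERIV_nonneg_imp_nondecreasing[OF that] G nonneg by blast
  have const: "G x = G y" if "x < y" "y \<le> 0 \<or> 1 \<le> x" for x y
  proof -
    have "\<exists>z. x < z \<and> z < y \<and> G y - G x = (y - x) * bump 1 0 z"
      using MVT2[OF that(1), of G "bump 1 0"] G by blast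
    then show ?thesis using that by (auto simp: bump_def split: if_splits)
  qed
  have "\<exists>z. 0 < z \<and> z < 1 \<and> G 1 - G 0 = (1 - 0) * bump 1 0 z"
    using MVT2[of 0 1 G "bump 1 0"] G by auto
  then have c: "0 < G 1 - G 0"
    by (elim exE conjE) (simp only: bump_def, simp)
  define c where "c = G 1 - G 0"
  define h where "h x = (G x - G 0) / c" for x
  \<comment> \<open>Dividing by the mass through a constant polynomial keeps \<open>\<rho>\<close>
    inside the family \<open>bump\<close>.\<close>
  define \<rho> where "\<rho> = bump [:1 / c:] 0"
  have \<rho>: "\<rho> x = bump 1 0 x / c" for x by (simp add: \<rho>_def bump_def)
  define F where "F = insert h {bump P m |P m. True}"
  have c0: "0 < c" using c by (simp add: c_def)
  have dh: "(h has_real_derivative \<rho> x) (at x)" for x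
    unfolding h_def \<rho> using G c0 by (auto intro!: derivative_eq_intros)
  have "\<exists>g\<in>F. \<forall>x. (f has_real_derivative g x) (at x)" if "f \<in> F" for f
    using that dh bump_has_derivative unfolding F_def \<rho>_def by blast
  moreover have "h \<in> F" "\<rho> \<in> F" by (auto simp: F_def \<rho>_def)
  moreover note dh
  moreover have "h x = 0" if "x \<le> 0" for x
    using const[of x 0] that by (cases "x = 0") (auto simp: h_def)
  moreover have "h x = 1" if "1 \<le> x" for x
    using const[of 1 x] that c0 by (cases "x = 1") (auto simp: h_def c_def)
  moreover have "0 \<le> h x" for x
    using mono[of 0 x] const[of x 0] c0 by (cases "0 \<le> x") (auto simp: h_def)
  moreover have "h x \<le> 1" for x
    using mono[of x 1] const[of 1 x] c0 by (cases "x \<le> 1") (auto simp: h_def c_def)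
  moreover have "\<rho> x = 0" if "x \<le> 0 \<or> 1 \<le> x" for x
    using that by (auto simp: \<rho> bump_def)
  moreover have "0 \<le> \<rho> x" for x
    using nonneg c0 by (simp add: \<rho>)
  moreover have "\<rho> x \<le> 1 / c" for x
    using c0 by (auto simp: \<rho> bump_def divide_right_mono)
  ultimately show thesis by (rule that)
qed

text \<open>The chain rule multiplies both coefficients by c, so the class of all such combinations
  is closed under differentiation. Kernels and differences of shifted steps are both
  instances.\<close>

lemma smooth_combination:
  assumes closed: "\<And>f. f \<in> F \<Longrightarrow> \<exists>g\<in>F. \<forall>x. (f has_real_derivative g x) (at x)"
    and "f \<in> F" "g \<in> F"
  shows "smooth_on UNIV (\<lambda>x. \<alpha> * f (c * (x - a)) + \<beta> * g (c * (x - b)) :: real)"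
proof (rule smooth_on_UNIV_if_deriv_closed)
  let ?G = "{(\<lambda>x. \<alpha> * f (c * (x - a)) + \<beta> * g (c * (x - b))) |\<alpha> \<beta> f g. f \<in> F \<and> g \<in> F}"
  show "(\<lambda>x. \<alpha> * f (c * (x - a)) + \<beta> * g (c * (x - b))) \<in> ?G" using assms by blast
  fix u assume "u \<in> ?G"
  then obtain \<alpha> \<beta> f g where u: "u = (\<lambda>x. \<alpha> * f (c * (x - a)) + \<beta> * g (c * (x - b)))"
    and "f \<in> F" "g \<in> F" by blast
  then obtain f' g' where "f' \<in> F" and f': "\<And>x. (f has_real_derivative f' x) (at x)"
    and "g' \<in> F" and g': "\<And>x. (g has_real_derivative g' x) (at x)"
    using closed by metis
  have "(u has_real_derivative (\<alpha> * c) * f' (c * (x - a)) + (\<beta> * c) * g' (c * (x - b))) (at x)" for x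
    unfolding u
    by (auto intro!: derivative_eq_intros DERIV_chain2[OF f'] DERIV_chain2[OF g'])
  moreover have "(\<lambda>x. (\<alpha> * c) * f' (c * (x - a)) + (\<beta> * c) * g' (c * (x - b))) \<in> ?G"
    using \<open>f' \<in> F\<close> \<open>g' \<in> F\<close> by blast
  ultimately show "\<exists>v\<in>?G. \<forall>x. (u has_real_derivative v x) (at x)"
    by (intro bexI[of _ "\<lambda>x. (\<alpha> * c) * f' (c * (x - a)) + (\<beta> * c) * g' (c * (x - b))"] allI)
qed

lemma test_functionsI:
  assumes "smooth_on UNIV \<psi>" and "0 < a" "b < R" and "\<And>x. x \<notin> {a..b} \<Longrightarrow> \<psi> x = 0"
  shows "\<psi> \<in> test_functions R"
proof -
  have sub: "closure {x. \<psi> x \<noteq> 0} \<subseteq> {a..b}"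
    using assms(4) by (intro closure_minimal subsetI closed_atLeastAtMost) blast
  then have "compact (closure {x. \<psi> x \<noteq> 0})"
    by (meson bounded_closed_interval bounded_subset closed_closure compact_eq_bounded_closed)
  moreover have "{a..b} \<subseteq> {0<..<R}" using assms by auto
  ultimately show ?thesis using sub assms(1) by (auto simp: test_functions_def)
qed

lemma iter_deriv_on_Suc_shift:
  "iter_deriv_on S (Suc n) f = iter_deriv_on S n (iter_deriv_on S 1 f)"
  by (induction n) (auto simp: fun_eq_iff)

text \<open>The function vanishes on the open complement of its support, so differentiation does not
  enlarge the support.\<close>

lemma test_functions_deriv:
  assumes "\<psi> \<in> test_functions R"
  shows "iter_deriv_on UNIV 1 \<psi> \<in> test_functions R"
proof -
  let ?S = "closure {x. \<psi> x \<noteq> 0}"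
  have "iter_deriv_on UNIV n (iter_deriv_on UNIV 1 \<psi>) differentiable_on UNIV" for n
    using assms iter_deriv_on_Suc_shift[of UNIV n \<psi>]
    by (metis (no_types, lifting) mem_Collect_eq smooth_on_def test_functions_def)
  then have smooth: "smooth_on UNIV (iter_deriv_on UNIV 1 \<psi>)" by (simp add: smooth_on_def)
  have "iter_deriv_on UNIV 1 \<psi> x = 0" if "x \<notin> ?S" for x
  proof -
    have "(\<psi> has_vector_derivative 0) (at x)"
    proof (rule has_vector_derivative_transform_within_open)
      show "((\<lambda>_. 0) has_vector_derivative 0) (at x)" by simp
      show "open (- ?S)" "x \<in> - ?S" using that by (auto simp: open_Compl)
      show "0 = \<psi> y" if "y \<in> - ?S" for y
        using that closure_subset[of "{x. \<psi> x \<noteq> 0}"] by fastforce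
    qed
    then show ?thesis by (simp add: vector_derivative_at)
  qed
  then have sub: "closure {x. iter_deriv_on UNIV 1 \<psi> x \<noteq> 0} \<subseteq> ?S"
    by (intro closure_minimal) auto
  have "compact ?S" "?S \<subseteq> {0<..<R}" using assms by (auto simp: test_functions_def)
  then have "compact (closure {x. iter_deriv_on UNIV 1 \<psi> x \<noteq> 0})"
    unfolding compact_eq_bounded_closed using sub bounded_subset closed_closure by blast
  then show ?thesis using smooth sub \<open>?S \<subseteq> {0<..<R}\<close> unfolding test_functions_def by blast
qed

section \<open>Weak derivatives and increments\<close>

text \<open>Testing order j against the derivative of a test function and order j + 1 against the
  function itself involves the same integral of v, and (-1)^j cancels. This reduces later work to
  first-order weak derivatives.\<close>

lemma has_weak_deriv_step:
  assumes "has_weak_deriv R j v g" "has_weak_deriv R (Suc j) v g'"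
  shows "has_weak_deriv R 1 g g'"
  unfolding has_weak_deriv_def
proof (intro conjI ballI)
  show "locally_integrable R g" "locally_integrable R g'"
    using assms by (auto simp: has_weak_deriv_def)
  fix \<psi> assume \<psi>: "\<psi> \<in> test_functions R"
  let ?D = "iter_deriv_on UNIV 1 \<psi>"
  have "(LINT t:{0<..<R}|lebesgue. v t * iter_deriv_on UNIV j ?D t) =
      (-1) ^ j * (LINT t:{0<..<R}|lebesgue. g t * ?D t)"
    using assms(1) test_functions_deriv[OF \<psi>] unfolding has_weak_deriv_def by blast
  moreover have "(LINT t:{0<..<R}|lebesgue. v t * iter_deriv_on UNIV j ?D t) =
      (-1) ^ (Suc j) * (LINT t:{0<..<R}|lebesgue. g' t * \<psi> t)"
    using assms(2) \<psi> unfolding has_weak_deriv_def iter_deriv_on_Suc_shift[of UNIV j] by blast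
  ultimately have "(-1) ^ j * (LINT t:{0<..<R}|lebesgue. g t * ?D t) =
      (-1) ^ j * ((-1) ^ 1 * (LINT t:{0<..<R}|lebesgue. g' t * \<psi> t))"
    by (simp only: power_Suc power_0 One_nat_def mult_1_right mult_minus_left mult_minus_right mult_1)
  then show "(LINT t:{0<..<R}|lebesgue. g t * ?D t) =
      (-1) ^ 1 * (LINT t:{0<..<R}|lebesgue. g' t * \<psi> t)"
    by (simp only: mult_cancel_left power_eq_0_iff neg_equal_0_iff_equal one_neq_zero simp_thms)
qed

lemma local_product_integrable:
  assumes "locally_integrable R f" "continuous_on {c..d} k" "0 < c" "d < R"
    and "\<And>t. t \<notin> {c..d} \<Longrightarrow> k t = 0"
  shows "set_integrable lebesgue {0<..<R} (\<lambda>t. f t * k t)"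
    and "(LINT t:{0<..<R}|lebesgue. f t * k t) = (LINT t:{c..d}|lebesgue. f t * k t)"
proof -
  have "{c..d} \<subseteq> {0<..<R}" using assms by auto
  then have eq: "(\<lambda>t. indicator {0<..<R} t *\<^sub>R (f t * k t)) =
      (\<lambda>t. indicator {c..d} t *\<^sub>R (f t * k t))"
    using assms(5) by (auto simp: fun_eq_iff indicator_def)
  show "(LINT t:{0<..<R}|lebesgue. f t * k t) = (LINT t:{c..d}|lebesgue. f t * k t)"
    unfolding set_lebesgue_integral_def eq ..
  have "f absolutely_integrable_on {c..d}"
    using assms(1) \<open>{c..d} \<subseteq> {0<..<R}\<close> compact_Icc unfolding locally_integrable_def by blast
  then have "(\<lambda>t. k t * f t) absolutely_integrable_on {c..d}"
    using assms(2)
    by (intro absolutely_integrable_bounded_measurable_product_real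
        continuous_imp_measurable_on_sets_lebesgue compact_imp_bounded compact_continuous_image) auto
  then show "set_integrable lebesgue {0<..<R} (\<lambda>t. f t * k t)"
    unfolding set_integrable_def eq by (simp add: mult.commute)
qed

text \<open>The conjunct \<open>0 < n\<close> excludes n = 0, where the default 1 / 0 = 0 also
  satisfies the inequality.\<close>

lemma eventually_inverse_le:
  assumes "0 < (d::real)"
  shows "\<forall>\<^sub>F n in sequentially. 0 < n \<and> 1 / real n \<le> d"
proof -
  obtain n0 where n0: "1 / d < real n0" using reals_Archimedean2 by blast
  show ?thesis
  proof (rule eventually_sequentiallyI[of n0])
    fix n assume "n0 \<le> n"
    then have "1 / d < real n" using n0 by (meson less_le_trans of_nat_mono)
    then show "0 < n \<and> 1 / real n \<le> d"
      using assms by (cases "n = 0") (simp_all add: field_simps)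
  qed
qed

section \<open>Approximate identities and smoothed indicators\<close>

locale smooth_step =
  fixes h \<rho> :: "real \<Rightarrow> real" and M :: real
  assumes step_deriv: "(h has_real_derivative \<rho> x) (at x)"
    and step_left: "x \<le> 0 \<Longrightarrow> h x = 0" and step_right: "1 \<le> x \<Longrightarrow> h x = 1"
    and step_nonneg: "0 \<le> h x" and step_le_1: "h x \<le> 1"
    and kernel_support: "x \<le> 0 \<or> 1 \<le> x \<Longrightarrow> \<rho> x = 0"
    and kernel_nonneg: "0 \<le> \<rho> x" and kernel_le: "\<rho> x \<le> M"
    and kernel_cont: "continuous_on UNIV \<rho>"
    and kernel_smooth: "smooth_on UNIV (\<lambda>x. c * \<rho> (c * (x - a)))"
    and step_diff_smooth: "smooth_on UNIV (\<lambda>x. h (c * (x - a)) - h (c * (x - b)))"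
begin

text \<open>An approximate identity of mass 1, supported in [a, a + 1/n]. The support lies to the
  right of a so that Lebesgue differentiation over the intervals [a, a + h] applies.\<close>

definition kern :: "nat \<Rightarrow> real \<Rightarrow> real \<Rightarrow> real" where
  "kern n a x = real n * \<rho> (real n * (x - a))"

text \<open>A primitive of the kernel at a minus the kernel at b: as a test function it turns the
  weak derivative identity into one between values near a and b and an integral over (a,b].\<close>

definition smooth_ind :: "nat \<Rightarrow> real \<Rightarrow> real \<Rightarrow> real \<Rightarrow> real" where
  "smooth_ind n a b x = h (real n * (x - a)) - h (real n * (x - b))"

lemma kern_nonneg: "0 \<le> kern n a x"
  by (simp add: kern_def kernel_nonneg)

lemma kern_le: "kern n a x \<le> real n * M"
  by (simp add: kern_def kernel_le mult_left_mono)

lemma kern_support: "0 < n \<Longrightarrow> x \<notin> {a..a + 1 / real n} \<Longrightarrow> kern n a x = 0"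
  unfolding kern_def
  by (subst kernel_support) (auto simp: field_simps mult_le_0_iff)

lemma kern_cont: "continuous_on A (kern n a)"
  unfolding kern_def
  by (intro continuous_intros continuous_on_compose2[OF kernel_cont]) auto

lemma step_cont: "continuous_on A h"
  using step_deriv by (meson DERIV_isCont continuous_at_imp_continuous_on)

lemma smooth_ind_cont: "continuous_on A (smooth_ind n a b)"
  unfolding smooth_ind_def
  by (intro continuous_intros continuous_on_compose2[OF step_cont[of UNIV]]) auto

lemma kern_has_integral:
  assumes "0 < n"
  shows "(kern n a has_integral 1) {a..a + 1 / real n}"
proof -
  have "((\<lambda>x. h (real n * (x - a))) has_real_derivative kern n a x) (at x within A)" for x A
    unfolding kern_def
    by (rule DERIV_subset[OF DERIV_cong[OF DERIV_chain2[OF step_deriv]]])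
       (auto intro!: derivative_eq_intros)
  then have "(kern n a has_integral
      h (real n * (a + 1 / real n - a)) - h (real n * (a - a))) {a..a + 1 / real n}"
    by (intro fundamental_theorem_of_calculus)
       (auto simp: has_real_derivative_iff_has_vector_derivative)
  then show ?thesis using assms by (simp add: step_left step_right)
qed

text \<open>For weighted averages, convergence of the plain averages of f is not enough; those of |f
  - f a| near a must be small. Differentiation is applied to |f - q| for each rational q, which
  keeps the exceptional set null, and then q is taken close to f a. The kernel is at most n M on an
  interval of length 1/n, so the weight costs only a factor M.\<close>

lemma kern_Lebesgue_point:
  assumes f: "\<And>a b. f absolutely_integrable_on {a..b::real}"
  shows "\<exists>N. negligible N \<and> (\<forall>a. a \<notin> N \<longrightarrow>
    (\<lambda>n. LINT t:{a..a + 1 / real n}|lebesgue. f t * kern n a t) \<longlonglongrightarrow> f a)"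
proof -
  have fq: "(\<lambda>t. \<bar>f t - q\<bar>) absolutely_integrable_on {a..b}" for a b q :: real
    using absolutely_integrable_norm[OF set_integral_diff(1)[OF f absolutely_integrable_on_const]]
    by (simp add: o_def)
  have "\<exists>N. negligible N \<and> (\<forall>x e. x \<notin> N \<longrightarrow> 0 < e \<longrightarrow> (\<exists>d>0. \<forall>h. 0 < h \<and> h < d \<longrightarrow>
      \<bar>integral {x..x + h} (\<lambda>t. \<bar>f t - q\<bar>) / h - \<bar>f x - q\<bar>\<bar> < e))" for q
    using integrable_ccontinuous_explicit[of "\<lambda>t. \<bar>f t - q\<bar>"] fq[THEN set_lebesgue_integral_eq_integral(1)]
    by (simp add: divide_inverse mult.commute) metis
  then obtain N where N: "\<And>q. negligible (N q)"
    and leb: "\<And>q x e. x \<notin> N q \<Longrightarrow> 0 < e \<Longrightarrow> (\<exists>d>0. \<forall>h. 0 < h \<and> h < d \<longrightarrow>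
      \<bar>integral {x..x + h} (\<lambda>t. \<bar>f t - q\<bar>) / h - \<bar>f x - q\<bar>\<bar> < e)"
    by metis
  show ?thesis
  proof (intro exI[of _ "\<Union>q\<in>\<rat>. N q"] conjI allI impI)
    show "negligible (\<Union>q\<in>\<rat>. N q)"
      using N by (intro negligible_countable_Union) (auto simp: countable_rat)
  next
    fix a assume a: "a \<notin> (\<Union>q\<in>\<rat>. N q)"
    have M0: "0 \<le> M" using kernel_nonneg[of 0] kernel_le[of 0] by linarith
    show "(\<lambda>n. LINT t:{a..a + 1 / real n}|lebesgue. f t * kern n a t) \<longlonglongrightarrow> f a"
    proof (rule LIMSEQ_I)
      fix e :: real assume "0 < e"
      \<comment> \<open>The final estimate is M (2 e') + 2 e', which equals e for this
        choice.\<close>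
      define e' where "e' = e / (2 * M + 2)"
      have e': "0 < e'" using \<open>0 < e\<close> M0 by (simp add: e'_def)
      obtain q where "q \<in> \<rat>" "f a < q" "q < f a + e'"
        using Rats_dense_in_real[of "f a" "f a + e'"] e' by auto
      then have q: "\<bar>f a - q\<bar> < e'" "a \<notin> N q" using a by auto
      obtain d where "0 < d" and d: "\<And>h. 0 < h \<Longrightarrow> h < d \<Longrightarrow>
          \<bar>integral {a..a + h} (\<lambda>t. \<bar>f t - q\<bar>) / h - \<bar>f a - q\<bar>\<bar> < e'"
        using leb[OF q(2) e'] by blast
      obtain n0 where n0: "1 / d < real n0" using reals_Archimedean2 by blast
      have "norm ((LINT t:{a..a + 1 / real n}|lebesgue. f t * kern n a t) - f a) < e"
        if "n0 \<le> n" for n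
      proof -
        let ?I = "{a..a + 1 / real n}"
        have "1 / d < real n" using n0 that by (meson less_le_trans of_nat_mono)
        then have n: "0 < n" "1 / real n < d"
          using \<open>0 < d\<close> by (cases "n = 0"; simp add: field_simps)+
        have "(\<lambda>t. kern n a t * f t) absolutely_integrable_on ?I"
        proof (rule absolutely_integrable_bounded_measurable_product_real)
          show "kern n a \<in> borel_measurable (lebesgue_on ?I)"
            by (intro continuous_imp_measurable_on_sets_lebesgue kern_cont) auto
          show "bounded (kern n a ` ?I)"
            by (intro compact_imp_bounded compact_continuous_image kern_cont compact_Icc)
        qed (use f in auto)
        then have fk: "(\<lambda>t. f t * kern n a t) absolutely_integrable_on ?I"
          by (simp add: mult.commute)
        have "((\<lambda>t. f t * kern n a t) has_integral
            (LINT t:?I|lebesgue. f t * kern n a t)) ?I"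
          by (rule has_integral_set_lebesgue[OF fk])
        from has_integral_diff[OF this has_integral_mult_right[OF kern_has_integral[OF n(1)], of "f a"]]
        have 1: "((\<lambda>t. f t * kern n a t - f a * kern n a t) has_integral
            (LINT t:?I|lebesgue. f t * kern n a t) - f a) ?I" by simp
        have "((\<lambda>t. \<bar>f t - q\<bar>) has_integral integral ?I (\<lambda>t. \<bar>f t - q\<bar>)) ?I"
          using fq[THEN set_lebesgue_integral_eq_integral(1)] by (rule integrable_integral)
        from has_integral_add[OF has_integral_mult_right[OF this, of "real n * M"]
            has_integral_mult_right[OF kern_has_integral[OF n(1)], of "\<bar>q - f a\<bar>"]]
        have 2: "((\<lambda>t. real n * M * \<bar>f t - q\<bar> + \<bar>q - f a\<bar> * kern n a t) has_integral
            real n * M * integral ?I (\<lambda>t. \<bar>f t - q\<bar>) + \<bar>q - f a\<bar>) ?I" by simp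
        have "norm ((LINT t:?I|lebesgue. f t * kern n a t) - f a)
            \<le> real n * M * integral ?I (\<lambda>t. \<bar>f t - q\<bar>) + \<bar>q - f a\<bar>"
        proof -
          have "norm (f t * kern n a t - f a * kern n a t) \<le> real n * M * \<bar>f t - q\<bar> + \<bar>q - f a\<bar> * kern n a t" for t
          proof -
            have "norm (f t * kern n a t - f a * kern n a t) = \<bar>f t - f a\<bar> * kern n a t"
              using kern_nonneg by (simp add: abs_mult left_diff_distrib[symmetric])
            also have "\<dots> \<le> (\<bar>f t - q\<bar> + \<bar>q - f a\<bar>) * kern n a t"
              using kern_nonneg by (intro mult_right_mono) auto
            also have "\<dots> \<le> \<bar>f t - q\<bar> * (real n * M) + \<bar>q - f a\<bar> * kern n a t"
              using kern_le by (simp add: distrib_right mult_left_mono)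
            finally show ?thesis by (simp add: ac_simps)
          qed
          then show ?thesis
            using integral_norm_bound_integral[OF has_integral_integrable[OF 1] has_integral_integrable[OF 2]]
              integral_unique[OF 1] integral_unique[OF 2] by metis
        qed
        also have "\<dots> \<le> M * (2 * e') + \<bar>q - f a\<bar>"
        proof -
          have "integral ?I (\<lambda>t. \<bar>f t - q\<bar>) * real n \<le> 2 * e'"
            using d[OF _ n(2)] n(1) q by auto
          from mult_left_mono[OF this M0] show ?thesis by (simp add: ac_simps)
        qed
        also have "\<dots> < M * (2 * e') + 2 * e'" using q e' by auto
        also have "\<dots> = e" 
        proof -
          have "e = e' * (2 * M + 2)" using M0 by (simp add: e'_def)
          then show ?thesis by (simp add: algebra_simps)
        qed
        finally show ?thesis .
      qed
      then show "\<exists>n0. \<forall>n\<ge>n0. norm ((LINT t:{a..a + 1 / real n}|lebesgue. f t * kern n a t) - f a) < e"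
        by blast
    qed
  qed
qed

text \<open>A locally integrable f need not be integrable near 0 or R, so it is cut off to compact
  intervals exhausting (0,R), and countably many exceptional sets are united. Kernels with large n
  do not see the cut-off.\<close>

lemma kern_Lebesgue_point_local:
  assumes f: "locally_integrable R f"
  shows "\<exists>N. negligible N \<and> (\<forall>a. a \<in> {0<..<R} - N \<longrightarrow>
    (\<lambda>n. LINT t:{0<..<R}|lebesgue. f t * kern n a t) \<longlonglongrightarrow> f a)"
proof -
  define \<epsilon> where "\<epsilon> m = 1 / real (Suc m)" for m
  have \<epsilon>: "0 < \<epsilon> m" for m by (simp add: \<epsilon>_def)
  define J where "J m = {\<epsilon> m..R - \<epsilon> m}" for m
  have J: "J m \<subseteq> {0<..<R}" for m using \<epsilon>[of m] by (auto simp: J_def)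
  define g where "g m t = indicator (J m) t *\<^sub>R f t" for m t
  have "g m absolutely_integrable_on {a..b}" for m a b
  proof -
    have "f absolutely_integrable_on J m"
      using f J unfolding locally_integrable_def J_def by blast
    then have "integrable lebesgue (g m)" by (simp add: set_integrable_def g_def[abs_def])
    then show ?thesis unfolding set_integrable_def
      by (intro integrable_mult_indicator) auto
  qed
  then have "\<exists>N. negligible N \<and> (\<forall>a. a \<notin> N \<longrightarrow>
      (\<lambda>n. LINT t:{a..a + 1 / real n}|lebesgue. g m t * kern n a t) \<longlonglongrightarrow> g m a)" for m
    by (rule kern_Lebesgue_point)
  from choice[OF allI[OF this]]
  obtain N where NN: "\<forall>m. negligible (N m) \<and> (\<forall>a. a \<notin> N m \<longrightarrow>
      (\<lambda>n. LINT t:{a..a + 1 / real n}|lebesgue. g m t * kern n a t) \<longlonglongrightarrow> g m a)" ..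
  have N: "negligible (N m)" for m using NN by simp
  note lim = NN[THEN spec, THEN conjunct2, THEN spec, THEN mp]
  show ?thesis
  proof (intro exI[of _ "\<Union>m. N m"] conjI allI impI)
    show "negligible (\<Union>m. N m)" using N by (intro negligible_countable_Union) auto
  next
    fix a assume a: "a \<in> {0<..<R} - (\<Union>m. N m)"
    \<comment> \<open>Half the distance to the boundary: one d is left for the kernel width 1/n, one
      for the margin \<open>\<epsilon> m\<close>.\<close>
    define d where "d = min a (R - a) / 2"
    have d: "0 < d" "2 * d \<le> a" "2 * d \<le> R - a" using a by (auto simp: d_def)
    obtain m where m: "\<epsilon> m < d"
      using reals_Archimedean[OF d(1)] by (auto simp: \<epsilon>_def inverse_eq_divide)
    have "\<forall>\<^sub>F n in sequentially. (LINT t:{a..a + 1 / real n}|lebesgue. g m t * kern n a t) =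
        (LINT t:{0<..<R}|lebesgue. f t * kern n a t)"
      using eventually_inverse_le[OF d(1)]
    proof eventually_elim
      case (elim n)
      have "\<epsilon> m \<le> a" "a + 1 / real n \<le> R - \<epsilon> m" using m d elim by linarith+
      then have "{a..a + 1 / real n} \<subseteq> J m" unfolding J_def by force
      with J[of m] have sub: "{a..a + 1 / real n} \<subseteq> J m" "{a..a + 1 / real n} \<subseteq> {0<..<R}" by blast+
      have "indicator {a..a + 1 / real n} t *\<^sub>R (g m t * kern n a t) =
          indicator {0<..<R} t *\<^sub>R (f t * kern n a t)" for t
      proof (cases "t \<in> {a..a + 1 / real n}")
        case True
        then have "t \<in> J m" "t \<in> {0<..<R}" using sub by blast+
        then show ?thesis using True by (simp add: g_def)
      next
        case False
        then have "kern n a t = 0" using kern_support elim by blast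
        then show ?thesis using False by simp
      qed
      then show ?case unfolding set_lebesgue_integral_def by (simp only:)
    qed
    moreover have "a \<in> J m" unfolding J_def using m d by simp
    then have "g m a = f a" by (simp add: g_def)
    then have "(\<lambda>n. LINT t:{a..a + 1 / real n}|lebesgue. g m t * kern n a t) \<longlonglongrightarrow> f a"
      using lim[of a m] a by simp
    ultimately show "(\<lambda>n. LINT t:{0<..<R}|lebesgue. f t * kern n a t) \<longlonglongrightarrow> f a"
      by (rule Lim_transform_eventually[rotated])
  qed
qed

lemma kern_test_function:
  assumes "0 < n" "0 < a" "a + 1 / real n < R"
  shows "kern n a \<in> test_functions R"
  using assms kernel_smooth[of "real n" a] kern_support
  by (intro test_functionsI[of _ a "a + 1 / real n"]) (auto simp: kern_def[abs_def])

lemma smooth_ind_support: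
  assumes "0 < n" "a < b" "x \<notin> {a..b + 1 / real n}"
  shows "smooth_ind n a b x = 0"
proof (cases "x < a")
  case True
  then have "real n * (x - a) \<le> 0" "real n * (x - b) \<le> 0"
    using assms by (auto simp: mult_le_0_iff)
  then show ?thesis by (simp add: smooth_ind_def step_left)
next
  case False
  then have "1 \<le> real n * (x - b)" using assms by (auto simp: field_simps)
  moreover have "real n * (x - b) \<le> real n * (x - a)" using assms by (intro mult_left_mono) auto
  ultimately show ?thesis by (simp add: smooth_ind_def step_right)
qed

lemma smooth_ind_test_function:
  assumes "0 < n" "0 < a" "a < b" "b + 1 / real n < R"
  shows "smooth_ind n a b \<in> test_functions R"
  using assms step_diff_smooth[of "real n" a b] smooth_ind_support
  by (intro test_functionsI[of _ a "b + 1 / real n"]) (auto simp: smooth_ind_def[abs_def])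

lemma smooth_ind_deriv:
  "iter_deriv_on UNIV 1 (smooth_ind n a b) = (\<lambda>t. kern n a t - kern n b t)"
proof
  fix t
  have "(smooth_ind n a b has_real_derivative kern n a t - kern n b t) (at t)"
    unfolding smooth_ind_def[abs_def] kern_def
    by (rule DERIV_cong[OF DERIV_diff[OF DERIV_chain2[OF step_deriv] DERIV_chain2[OF step_deriv]]])
       (auto intro!: derivative_eq_intros)
  then show "iter_deriv_on UNIV 1 (smooth_ind n a b) t = kern n a t - kern n b t"
    by (simp add: has_real_derivative_iff_has_vector_derivative vector_derivative_at)
qed

text \<open>As h vanishes at 0, the limit is 0 at a and 1 at b, which yields exactly the half-open
  interval.\<close>

lemma smooth_ind_tendsto:
  assumes "a < b"
  shows "(\<lambda>n. smooth_ind n a b t) \<longlonglongrightarrow> indicator {a<..b} t"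
proof -
  have lim: "(\<lambda>n. h (real n * x)) \<longlonglongrightarrow> (if 0 < x then 1 else 0)" for x
  proof (cases "0 < x")
    case True
    show ?thesis
      by (rule tendsto_eventually, use eventually_inverse_le[OF True] in eventually_elim)
         (use True in \<open>auto simp: field_simps intro!: step_right\<close>)
  next
    case False
    then show ?thesis by (simp add: step_left mult_nonneg_nonpos)
  qed
  have "(\<lambda>n. smooth_ind n a b t) \<longlonglongrightarrow>
      (if 0 < t - a then 1 else 0) - (if 0 < t - b then 1 else 0)"
    unfolding smooth_ind_def by (intro tendsto_diff lim)
  also have "(if 0 < t - a then 1 else 0) - (if 0 < t - b then 1 else (0::real)) = indicator {a<..b} t"
    using assms by (auto simp: indicator_def)
  finally show ?thesis .
qed

lemma smooth_ind_integral_tendsto: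
  assumes f: "locally_integrable R f" and ab: "0 < a" "a < b" "b < R"
  shows "(\<lambda>n. LINT t:{0<..<R}|lebesgue. f t * smooth_ind n a b t) \<longlonglongrightarrow>
    (LINT t:{a<..b}|lebesgue. f t)"
proof -
  \<comment> \<open>The supports [a, b + 1/n] eventually lie in [a, c], a compact interval on which
    |f| is an integrable majorant.\<close>
  define c where "c = (b + R) / 2"
  have c: "b < c" "c < R" using ab by (auto simp: c_def)
  then have pos: "0 < c - b" by simp
  have fc: "f absolutely_integrable_on {a..c}"
  proof -
    have "{a..c} \<subseteq> {0<..<R}" using ab c by auto
    then show ?thesis using f compact_Icc unfolding locally_integrable_def by blast
  qed
  have "(\<lambda>n. LINT t|lebesgue. indicator {a..c} t *\<^sub>R (f t * smooth_ind n a b t)) \<longlonglongrightarrow>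
      (LINT t|lebesgue. indicator {a<..b} t *\<^sub>R f t)"
  proof (rule integral_dominated_convergence)
    show "integrable lebesgue (\<lambda>t. norm (indicator {a..c} t *\<^sub>R f t))"
      using fc unfolding set_integrable_def by (rule integrable_norm)
    have "{a<..b} \<subseteq> {a..c}" using c by auto
    then have "f absolutely_integrable_on {a<..b}"
      by (intro set_integrable_subset[OF fc]) auto
    then show "(\<lambda>t. indicator {a<..b} t *\<^sub>R f t) \<in> borel_measurable lebesgue"
      by (auto simp: set_integrable_def)
    have "smooth_ind n a b \<in> borel_measurable lebesgue" for n
      by (intro measurable_completion) (simp add: borel_measurable_continuous_onI smooth_ind_cont)
    moreover have "(\<lambda>t. indicator {a..c} t *\<^sub>R f t) \<in> borel_measurable lebesgue"
      using fc by (auto simp: set_integrable_def)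
    ultimately have "(\<lambda>t. (indicator {a..c} t *\<^sub>R f t) * smooth_ind n a b t) \<in> borel_measurable lebesgue" for n
      by (intro borel_measurable_times)
    then show "(\<lambda>t. indicator {a..c} t *\<^sub>R (f t * smooth_ind n a b t)) \<in> borel_measurable lebesgue" for n
      by (simp add: mult.assoc)
    have "(\<lambda>n. indicator {a..c} t *\<^sub>R (f t * smooth_ind n a b t)) \<longlonglongrightarrow>
        indicator {a..c} t *\<^sub>R (f t * indicator {a<..b} t)" for t
      by (intro tendsto_intros smooth_ind_tendsto ab)
    moreover have "indicator {a..c} t *\<^sub>R (f t * indicator {a<..b} t) = indicator {a<..b} t *\<^sub>R f t" for t
      using c by (auto simp: indicator_def)
    ultimately show "AE t in lebesgue. (\<lambda>n. indicator {a..c} t *\<^sub>R (f t * smooth_ind n a b t))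
        \<longlonglongrightarrow> indicator {a<..b} t *\<^sub>R f t"
      by (simp only: AE_I2)
    have "\<bar>smooth_ind n a b t\<bar> \<le> 1" for n t
      using step_nonneg[of "real n * (t - a)"] step_nonneg[of "real n * (t - b)"]
        step_le_1[of "real n * (t - a)"] step_le_1[of "real n * (t - b)"]
      by (simp add: smooth_ind_def abs_le_iff)
    then have "norm (indicator {a..c} t *\<^sub>R (f t * smooth_ind n a b t))
        \<le> norm (indicator {a..c} t *\<^sub>R f t)" for n t
      by (cases "t \<in> {a..c}") (simp_all add: abs_mult mult_left_le)
    then show "AE t in lebesgue. norm (indicator {a..c} t *\<^sub>R (f t * smooth_ind n a b t))
        \<le> norm (indicator {a..c} t *\<^sub>R f t)" for n
      by (intro always_eventually allI)
  qed
  moreover have "\<forall>\<^sub>F n in sequentially.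
      (LINT t|lebesgue. indicator {a..c} t *\<^sub>R (f t * smooth_ind n a b t)) =
      (LINT t:{0<..<R}|lebesgue. f t * smooth_ind n a b t)"
    using eventually_inverse_le[OF pos]
  proof eventually_elim
    case (elim n)
    then have "smooth_ind n a b t = 0" if "t \<notin> {a..c}" for t
      by (intro smooth_ind_support) (use that ab in auto)
    from local_product_integrable(2)[OF f smooth_ind_cont ab(1) c(2) this]
    show ?case unfolding set_lebesgue_integral_def by (rule sym)
  qed
  ultimately show ?thesis
    unfolding set_lebesgue_integral_def[of _ "{a<..b}"] by (rule Lim_transform_eventually)
qed

text \<open>The sign (-1)^1 turns kernel at a minus kernel at b into v b - v a. The null set comes
  from the kernel averages of v alone, so it serves all a and b at once.\<close>

lemma weak_deriv_increment:
  assumes "has_weak_deriv R 1 v g"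
  obtains N where "negligible N"
    "\<And>a b. a \<in> {0<..<R} - N \<Longrightarrow> b \<in> {0<..<R} - N \<Longrightarrow> a < b \<Longrightarrow>
      v b - v a = (LINT t:{a<..b}|lebesgue. g t)"
proof -
  have v: "locally_integrable R v" and g: "locally_integrable R g"
    using assms by (auto simp: has_weak_deriv_def)
  obtain N where N: "negligible N \<and> (\<forall>a. a \<in> {0<..<R} - N \<longrightarrow>
      (\<lambda>n. LINT t:{0<..<R}|lebesgue. v t * kern n a t) \<longlonglongrightarrow> v a)"
    using kern_Lebesgue_point_local[OF v] ..
  note lim = N[THEN conjunct2, THEN spec, THEN mp]
  show thesis
  proof
    show "negligible N" using N ..
  next
    fix a b assume a: "a \<in> {0<..<R} - N" and b: "b \<in> {0<..<R} - N" and "a < b"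
    have pos: "0 < (R - b) / 2" using b by simp
    have "\<forall>\<^sub>F n in sequentially.
        (LINT t:{0<..<R}|lebesgue. v t * kern n b t) - (LINT t:{0<..<R}|lebesgue. v t * kern n a t)
        = (LINT t:{0<..<R}|lebesgue. g t * smooth_ind n a b t)"
      using eventually_inverse_le[OF pos]
    proof eventually_elim
      case (elim n)
      have "b < R" using b by simp
      define x where "x = 1 / real n"
      have "0 < n" "x \<le> (R - b) / 2" using elim by (simp_all only: x_def)
      with \<open>a < b\<close> \<open>b < R\<close> have n: "0 < n" "a + 1 / real n < R" "b + 1 / real n < R"
        unfolding x_def[symmetric] by argo+
      have "set_integrable lebesgue {0<..<R} (\<lambda>t. v t * kern n x t)" if "x = a \<or> x = b" for x
        using a b n that
        by (intro local_product_integrable(1)[OF v kern_cont[of "{x..x + 1 / real n}"]] kern_support) auto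
      then have "(LINT t:{0<..<R}|lebesgue. v t * (kern n a t - kern n b t)) =
          (LINT t:{0<..<R}|lebesgue. v t * kern n a t) - (LINT t:{0<..<R}|lebesgue. v t * kern n b t)"
        by (subst set_integral_diff(2)[symmetric]) (auto simp: right_diff_distrib)
      moreover have "(LINT t:{0<..<R}|lebesgue. v t * iter_deriv_on UNIV 1 (smooth_ind n a b) t) =
          (-1) ^ 1 * (LINT t:{0<..<R}|lebesgue. g t * smooth_ind n a b t)"
        using assms smooth_ind_test_function[of n a b R] a n \<open>a < b\<close>
        unfolding has_weak_deriv_def by auto
      ultimately show ?case unfolding smooth_ind_deriv by simp
    qed
    moreover have "(\<lambda>n. (LINT t:{0<..<R}|lebesgue. v t * kern n b t)
        - (LINT t:{0<..<R}|lebesgue. v t * kern n a t)) \<longlonglongrightarrow> v b - v a"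
      by (intro tendsto_diff lim a b)
    ultimately have "(\<lambda>n. LINT t:{0<..<R}|lebesgue. g t * smooth_ind n a b t) \<longlonglongrightarrow> v b - v a"
      by (rule Lim_transform_eventually[rotated])
    moreover have "(\<lambda>n. LINT t:{0<..<R}|lebesgue. g t * smooth_ind n a b t) \<longlonglongrightarrow>
        (LINT t:{a<..b}|lebesgue. g t)"
      using a b \<open>a < b\<close> by (intro smooth_ind_integral_tendsto g) auto
    ultimately show "v b - v a = (LINT t:{a<..b}|lebesgue. g t)"
      by (rule LIMSEQ_unique)
  qed
qed

text \<open>Order 0 only says that v and g agree against test functions; the kernels recover the
  values at common Lebesgue points. It is needed because \<open>weak_deriv R 0 v\<close> is a choice
  that may differ from v on a null set.\<close>

lemma weak_deriv_0_AE_eq: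
  assumes "has_weak_deriv R 0 v g"
  shows "AE t in lebesgue. t \<in> {0<..<R} \<longrightarrow> v t = g t"
proof -
  have v: "locally_integrable R v" and g: "locally_integrable R g"
    using assms by (auto simp: has_weak_deriv_def)
  obtain N where N: "negligible N \<and> (\<forall>a. a \<in> {0<..<R} - N \<longrightarrow>
      (\<lambda>n. LINT t:{0<..<R}|lebesgue. v t * kern n a t) \<longlonglongrightarrow> v a)"
    using kern_Lebesgue_point_local[OF v] ..
  note limv = N[THEN conjunct2, THEN spec, THEN mp]
  obtain N' where N': "negligible N' \<and> (\<forall>a. a \<in> {0<..<R} - N' \<longrightarrow>
      (\<lambda>n. LINT t:{0<..<R}|lebesgue. g t * kern n a t) \<longlonglongrightarrow> g a)"
    using kern_Lebesgue_point_local[OF g] ..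
  note limg = N'[THEN conjunct2, THEN spec, THEN mp]
  have "v a = g a" if a: "a \<in> {0<..<R} - (N \<union> N')" for a
  proof (rule LIMSEQ_unique[OF _ limg])
    have pos: "0 < (R - a) / 2" using a by simp
    have "\<forall>\<^sub>F n in sequentially. (LINT t:{0<..<R}|lebesgue. v t * kern n a t) =
        (LINT t:{0<..<R}|lebesgue. g t * kern n a t)"
      using eventually_inverse_le[OF pos]
    proof eventually_elim
      case (elim n)
      then have "kern n a \<in> test_functions R"
        using a by (intro kern_test_function) (auto simp: field_simps)
      then show ?case using assms unfolding has_weak_deriv_def by auto
    qed
    moreover have "(\<lambda>n. LINT t:{0<..<R}|lebesgue. v t * kern n a t) \<longlonglongrightarrow> v a"
      by (rule limv) (use a in blast)
    ultimately show "(\<lambda>n. LINT t:{0<..<R}|lebesgue. g t * kern n a t) \<longlonglongrightarrow> v a"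
      by (rule Lim_transform_eventually[rotated])
  qed (use a in blast)
  moreover have "N \<union> N' \<in> null_sets lebesgue"
    using N N' unfolding negligible_iff_null_sets by blast
  ultimately show ?thesis by (auto intro!: AE_I'[of "N \<union> N'"])
qed

end

lemma ex_smooth_step: "\<exists>h \<rho> M. smooth_step h \<rho> M"
proof -
  obtain h \<rho> :: "real \<Rightarrow> real" and F M where
    F: "\<And>f. f \<in> F \<Longrightarrow> \<exists>g\<in>F. \<forall>x. (f has_real_derivative g x) (at x)"
    and mem: "h \<in> F" "\<rho> \<in> F"
    and props: "\<And>x. (h has_real_derivative \<rho> x) (at x)"
    "\<And>x. x \<le> 0 \<Longrightarrow> h x = 0" "\<And>x. 1 \<le> x \<Longrightarrow> h x = 1"
    "\<And>x. 0 \<le> h x" "\<And>x. h x \<le> 1"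
    "\<And>x. x \<le> 0 \<or> 1 \<le> x \<Longrightarrow> \<rho> x = 0"
    "\<And>x. 0 \<le> \<rho> x" "\<And>x. \<rho> x \<le> M"
    by (rule smooth_step_function_exists) blast
  have "smooth_step h \<rho> M"
  proof
    obtain \<rho>' where "\<And>x. (\<rho> has_real_derivative \<rho>' x) (at x)" using F mem by blast
    then show "continuous_on UNIV \<rho>"
      by (meson DERIV_isCont continuous_at_imp_continuous_on)
    show "smooth_on UNIV (\<lambda>x. c * \<rho> (c * (x - a)))" for c a
      using smooth_combination[OF F mem(2) mem(2), where \<alpha> = c and \<beta> = 0] by simp
    show "smooth_on UNIV (\<lambda>x. h (c * (x - a)) - h (c * (x - b)))" for c a b
      using smooth_combination[OF F mem(1) mem(1), where \<alpha> = 1 and \<beta> = "-1"] by simp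
  qed (use props in auto)
  then show ?thesis by blast
qed

section \<open>Weighted tail estimates\<close>

text \<open>The quotient \<phi> t / t tends to \<phi>'(0) = 1 at 0, lies between positive constants
  near R by the lower and upper limits, and attains a positive minimum and a maximum on the compact
  interval in between.\<close>

lemma linear_bounds:
  fixes \<phi> :: "real \<Rightarrow> real"
  assumes "0 < R" and smooth: "smooth_on {0..<R} \<phi>"
    and pos: "\<forall>t\<in>{0<..<R}. 0 < \<phi> t"
    and zero: "\<phi> 0 = 0" and one: "iter_deriv_on {0..<R} 1 \<phi> 0 = 1"
    and liminf: "0 < Liminf (at_left R) (\<lambda>r. ereal (\<phi> r))"
    and limsup: "Limsup (at_left R) (\<lambda>r. ereal (\<phi> r)) < \<infinity>"
  shows "\<exists>c>0. \<exists>C>0. \<forall>t\<in>{0<..<R}. c * t \<le> \<phi> t \<and> \<phi> t \<le> C * t"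
proof -
  have diff: "\<phi> differentiable_on {0..<R}"
    using smooth unfolding smooth_on_def by (metis iter_deriv_on.simps(1))
  then have "(\<phi> has_vector_derivative 1) (at 0 within {0..<R})"
    using one \<open>0 < R\<close> vector_derivative_works[of \<phi> "at 0 within {0..<R}"]
    by (auto simp: differentiable_on_def)
  then have lim: "((\<lambda>y. \<phi> y / y) \<longlongrightarrow> 1) (at 0 within {0..<R})"
    by (simp add: has_real_derivative_iff_has_vector_derivative[symmetric] has_field_derivative_iff zero)
  have "\<forall>\<^sub>F y in at 0 within {0..<R}. 1/2 < \<phi> y / y \<and> \<phi> y / y < 2"
    by (intro eventually_conj order_tendstoD[OF lim]) auto
  then obtain d where "0 < d" and d: "\<And>y. 0 < y \<Longrightarrow> y < R \<Longrightarrow> y < d \<Longrightarrow> 1/2 < \<phi> y / y \<and> \<phi> y / y < 2"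
    by (auto simp: eventually_at dist_real_def)
  obtain e where e: "0 < ereal e" "ereal e < Liminf (at_left R) (\<lambda>r. ereal (\<phi> r))"
    using ereal_dense2[OF liminf] by blast
  obtain E where E: "Limsup (at_left R) (\<lambda>r. ereal (\<phi> r)) < ereal E"
    using ereal_dense2[OF limsup] by blast
  have "\<forall>\<^sub>F r in at_left R. e < \<phi> r \<and> \<phi> r < E"
    using less_LiminfD[OF e(2)] Limsup_lessD[OF E] by eventually_elim simp
  then obtain r0 where "r0 < R" and r0: "\<And>r. r0 < r \<Longrightarrow> r < R \<Longrightarrow> e < \<phi> r \<and> \<phi> r < E"
    by (auto simp: eventually_at_left[OF \<open>0 < R\<close>])
  \<comment> \<open>a lies in the zone controlled by the derivative at 0, b in the zone controlled
    near R; the maximum ensures a \<le> b.\<close>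
  define a where "a = min d R / 2"
  define b where "b = max ((r0 + R) / 2) a"
  have ab: "0 < a" "a < d" "a < R" "a \<le> b" "b < R" "r0 < b"
    using \<open>0 < d\<close> \<open>0 < R\<close> \<open>r0 < R\<close> by (auto simp: a_def b_def less_max_iff_disj)
  have "continuous_on {a..b} (\<lambda>t. \<phi> t / t)"
    by (intro continuous_intros continuous_on_subset[OF differentiable_imp_continuous_on[OF diff]])
       (use ab in auto)
  then have cpt: "compact ((\<lambda>t. \<phi> t / t) ` {a..b})" "(\<lambda>t. \<phi> t / t) ` {a..b} \<noteq> {}"
    using ab by (auto intro: compact_continuous_image)
  obtain x where x: "x \<in> {a..b}" "\<And>t. t \<in> {a..b} \<Longrightarrow> \<phi> x / x \<le> \<phi> t / t"
    using compact_attains_inf[OF cpt] by auto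
  obtain y where y: "y \<in> {a..b}" "\<And>t. t \<in> {a..b} \<Longrightarrow> \<phi> t / t \<le> \<phi> y / y"
    using compact_attains_sup[OF cpt] by auto
  \<comment> \<open>Near R the quotient is at least e / R because t < R, and at most E / a because t
    > a.\<close>
  define c where "c = min (1/2) (min (\<phi> x / x) (e / R))"
  define C where "C = max 2 (max (\<phi> y / y) (E / a))"
  have "0 < c" using x(1) ab pos e(1) \<open>0 < R\<close> by (auto simp: c_def)
  moreover have "0 < C" by (simp add: C_def)
  moreover have "c * t \<le> \<phi> t \<and> \<phi> t \<le> C * t" if t: "t \<in> {0<..<R}" for t
  proof -
    have "c \<le> \<phi> t / t \<and> \<phi> t / t \<le> C"
    proof -
      consider "t < a" | "t \<in> {a..b}" | "b < t" by force
      then show ?thesis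
      proof cases
        case 1
        then have "1/2 < \<phi> t / t \<and> \<phi> t / t < 2" using d[of t] t ab by auto
        moreover have "c \<le> 1/2" "2 \<le> C" unfolding c_def C_def by (rule min.cobounded1 max.cobounded1)+
        ultimately show ?thesis by linarith
      next
        case 2
        then show ?thesis using x(2)[OF 2] y(2)[OF 2] by (auto simp: c_def C_def)
      next
        case 3
        have "e / R \<le> \<phi> t / t"
          using r0[of t] 3 ab t e(1) by (intro frac_le) auto
        moreover have "\<phi> t / t \<le> E / a"
          using r0[of t] 3 ab t e(1) by (intro frac_le) auto
        ultimately show ?thesis by (auto simp: c_def C_def)
      qed
    qed
    then show ?thesis using t by (auto simp: field_simps)
  qed
  ultimately show ?thesis by blast
qed

lemma set_integral_mono_set_nonneg:
  fixes f :: "'a \<Rightarrow> real"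
  assumes "set_integrable M B f" "A \<in> sets M" "A \<subseteq> B" "\<And>x. x \<in> B \<Longrightarrow> 0 \<le> f x"
  shows "(LINT x:A|M. f x) \<le> (LINT x:B|M. f x)"
  unfolding set_lebesgue_integral_def
proof (rule integral_mono)
  show "integrable M (\<lambda>x. indicator A x *\<^sub>R f x)"
    using set_integrable_subset[OF assms(1-3)] by (simp add: set_integrable_def)
  show "integrable M (\<lambda>x. indicator B x *\<^sub>R f x)"
    using assms(1) by (simp add: set_integrable_def)
  show "indicator A x *\<^sub>R f x \<le> indicator B x *\<^sub>R f x" for x
    using assms(3,4) by (auto simp: indicator_def)
qed

text \<open>The contribution of the upper endpoint is nonpositive and is dropped, so the bound is
  uniform as b approaches R.\<close>

lemma powr_tail_integral:
  fixes a b \<beta> :: real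
  assumes "1 < \<beta>" "0 < a" "a < b"
  shows "set_integrable lebesgue {a<..b} (\<lambda>t. t powr (- \<beta>))"
    and "(LINT t:{a<..b}|lebesgue. t powr (- \<beta>)) \<le> a powr (1 - \<beta>) / (\<beta> - 1)"
proof -
  let ?F = "\<lambda>t. t powr (1 - \<beta>) / (1 - \<beta>)"
  have "(?F has_real_derivative t powr (- \<beta>)) (at t within {a..b})" if "t \<in> {a..b}" for t
    using assms that
    by (intro DERIV_cong[OF DERIV_cdivide[OF has_field_derivative_at_within[OF has_real_derivative_powr]]]) auto
  then have I: "((\<lambda>t. t powr (- \<beta>)) has_integral (?F b - ?F a)) {a..b}"
    using assms by (intro fundamental_theorem_of_calculus)
      (auto simp: has_real_derivative_iff_has_vector_derivative)
  then have abs: "(\<lambda>t. t powr (- \<beta>)) absolutely_integrable_on {a..b}"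
    by (intro nonnegative_absolutely_integrable_1) (auto simp: integrable_on_def)
  then show "set_integrable lebesgue {a<..b} (\<lambda>t. t powr (- \<beta>))"
    by (rule set_integrable_subset) auto
  have "(LINT t:{a<..b}|lebesgue. t powr (- \<beta>)) \<le> (LINT t:{a..b}|lebesgue. t powr (- \<beta>))"
    by (rule set_integral_mono_set_nonneg[OF abs]) auto
  also have "\<dots> = ?F b - ?F a"
    using set_lebesgue_integral_eq_integral(2)[OF abs] integral_unique[OF I] by simp
  also have "\<dots> \<le> a powr (1 - \<beta>) / (\<beta> - 1)"
  proof -
    have "?F b - ?F a = a powr (1 - \<beta>) / (\<beta> - 1) - b powr (1 - \<beta>) / (\<beta> - 1)"
      using assms by (simp add: field_simps)
    then show ?thesis using assms by simp
  qed
  finally show "(LINT t:{a<..b}|lebesgue. t powr (- \<beta>)) \<le> a powr (1 - \<beta>) / (\<beta> - 1)" .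
qed

lemma locally_integrable_Ioc:
  assumes "locally_integrable R g" "0 < a" "b < R"
  shows "set_integrable lebesgue {a<..b} g"
proof -
  have "{a..b} \<subseteq> {0<..<R}" using assms by auto
  then have "set_integrable lebesgue {a..b} g"
    using assms(1) compact_Icc unfolding locally_integrable_def by blast
  then show ?thesis by (rule set_integrable_subset) auto
qed

text \<open>Above the threshold, x = x^p x^(1-p), and 1 - p is nonpositive, so x may be replaced by
  m in the second factor.\<close>

lemma le_add_powr_mult:
  fixes x m p :: real
  assumes "0 < m" "0 \<le> x" "1 \<le> p"
  shows "x \<le> m + x powr p * m powr (1 - p)"
proof (cases "x \<le> m")
  case True
  then show ?thesis by (simp add: add_increasing2)
next
  case False
  then have "x = x powr p * x powr (1 - p)" using assms by (simp add: powr_add[symmetric])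
  also have "\<dots> \<le> x powr p * m powr (1 - p)"
    using False assms by (intro mult_left_mono powr_mono2') auto
  finally show ?thesis using assms by linarith
qed

text \<open>With \<beta> = (m+1)/p, the threshold A t^(-\<beta>) raised to the power 1 - p is
  A^(1-p) t^m t^(1-\<beta>): the weight takes up t^m, and t^(1-\<beta>) is at most a^(1-\<beta>).
  The two summands in the constant are the integrals of the two parts of the splitting.\<close>

lemma Lp_tail_integral:
  fixes R p A c :: real and m :: nat
  assumes "1 \<le> p" "p < real (Suc m)" "0 < A" "0 < c" "0 < a" "a < b" "b < R"
    and g: "locally_integrable R g"
    and w: "\<And>t. t \<in> {0<..<R} \<Longrightarrow> c * t ^ m \<le> w t"
    and int: "set_integrable lebesgue {0<..<R} (\<lambda>t. \<bar>g t\<bar> powr p * w t)"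
    and le: "(LINT t:{0<..<R}|lebesgue. \<bar>g t\<bar> powr p * w t) \<le> A powr p"
  shows "(LINT t:{a<..b}|lebesgue. \<bar>g t\<bar>) \<le>
    A * (1 / (real (Suc m) / p - 1) + 1 / c) * a powr (- (real (Suc m) / p - 1))"
proof -
  define n where "n = real (Suc m)"
  define \<beta> where "\<beta> = n / p"
  have \<beta>: "1 < \<beta>" "\<beta> * p = n" using assms by (auto simp: \<beta>_def n_def field_simps)
  \<comment> \<open>The integral bound A^p will later restore the exponent of A to 1; 1/c comes from
    replacing t^m by the weight.\<close>
  define B where "B = A powr (1 - p) * a powr (1 - \<beta>) / c"
  have "0 \<le> B" using assms by (simp add: B_def)
  have sub: "{a<..b} \<subseteq> {0<..<R}" using assms by auto
  have w0: "0 \<le> w t" if "t \<in> {0<..<R}" for t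
  proof -
    have "0 \<le> c * t ^ m" using that \<open>0 < c\<close> by simp
    then show ?thesis using w[OF that] by linarith
  qed
  have ptw: "\<bar>g t\<bar> \<le> A * t powr (- \<beta>) + B * (\<bar>g t\<bar> powr p * w t)" if t: "t \<in> {a<..b}" for t
  proof -
    have t': "0 < t" "t \<in> {0<..<R}" "a < t" using t sub assms by auto
    have "(A * t powr (- \<beta>)) powr (1 - p) = A powr (1 - p) * t powr (n - \<beta>)"
      using assms t' \<beta>(2) by (simp add: powr_mult powr_powr algebra_simps)
    also have "t powr (n - \<beta>) = t ^ m * t powr (1 - \<beta>)"
      using t' by (simp add: n_def powr_realpow[symmetric] powr_add[symmetric] add_diff_eq add.commute)
    also have "\<dots> \<le> (w t / c) * a powr (1 - \<beta>)"
      using w[OF t'(2)] w0[OF t'(2)] t' assms \<beta>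
      by (intro mult_mono powr_mono2') (auto simp: field_simps)
    also have "A powr (1 - p) * ((w t / c) * a powr (1 - \<beta>)) = B * w t"
      by (simp add: B_def)
    finally have "(A * t powr (- \<beta>)) powr (1 - p) \<le> B * w t"
      using assms by (simp add: mult_left_mono)
    then have "\<bar>g t\<bar> powr p * (A * t powr (- \<beta>)) powr (1 - p) \<le> \<bar>g t\<bar> powr p * (B * w t)"
      by (intro mult_left_mono) auto
    moreover have "\<bar>g t\<bar> \<le> A * t powr (- \<beta>) + \<bar>g t\<bar> powr p * (A * t powr (- \<beta>)) powr (1 - p)"
      using assms t' by (intro le_add_powr_mult) auto
    ultimately show ?thesis by (simp add: ac_simps)
  qed
  note P = powr_tail_integral[OF \<beta>(1) \<open>0 < a\<close> \<open>a < b\<close>]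
  have intab: "set_integrable lebesgue {a<..b} (\<lambda>t. \<bar>g t\<bar> powr p * w t)"
    by (rule set_integrable_subset[OF int _ sub]) auto
  have I1: "set_integrable lebesgue {a<..b} (\<lambda>t. A * t powr (- \<beta>))"
    using P(1) by simp
  have I2: "set_integrable lebesgue {a<..b} (\<lambda>t. B * (\<bar>g t\<bar> powr p * w t))"
    using intab by simp
  have "(LINT t:{a<..b}|lebesgue. \<bar>g t\<bar>) \<le>
      (LINT t:{a<..b}|lebesgue. A * t powr (- \<beta>) + B * (\<bar>g t\<bar> powr p * w t))"
    by (intro set_integral_mono set_integrable_abs locally_integrable_Ioc[OF g] set_integral_add(1) I1 I2 ptw)
       (use assms in auto)
  also have "\<dots> = A * (LINT t:{a<..b}|lebesgue. t powr (- \<beta>)) +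
      B * (LINT t:{a<..b}|lebesgue. \<bar>g t\<bar> powr p * w t)"
    by (simp only: set_integral_add(2)[OF I1 I2] set_integral_mult_right)
  also have "\<dots> \<le> A * (a powr (1 - \<beta>) / (\<beta> - 1)) + B * A powr p"
  proof (intro add_mono mult_left_mono P(2) \<open>0 \<le> B\<close>)
    show "(LINT t:{a<..b}|lebesgue. \<bar>g t\<bar> powr p * w t) \<le> A powr p"
      by (rule order_trans[OF set_integral_mono_set_nonneg[OF int _ sub] le]) (simp_all add: w0)
  qed (use assms in auto)
  also have "B * A powr p = (A powr (1 - p) * A powr p) * a powr (1 - \<beta>) / c"
    by (simp add: B_def)
  also have "A powr (1 - p) * A powr p = A" using assms by (simp add: powr_add[symmetric])
  finally show ?thesis
    by (simp add: \<beta>_def n_def algebra_simps add_divide_distrib)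
qed

text \<open>The counterpart of \<open>Lp_tail_integral\<close> for lower orders, where a power bound
  is already known, though only almost everywhere.\<close>

lemma pointwise_tail_integral:
  assumes "1 < \<beta>" "0 \<le> B" "0 < a" "a < b" "b < R"
    and g: "locally_integrable R g"
    and ae: "AE t in lebesgue. t \<in> {0<..<R} \<longrightarrow> \<bar>g t\<bar> \<le> B * t powr (- \<beta>)"
  shows "(LINT t:{a<..b}|lebesgue. \<bar>g t\<bar>) \<le> B / (\<beta> - 1) * a powr (- (\<beta> - 1))"
proof -
  note P = powr_tail_integral[OF assms(1,3,4)]
  have "(LINT t:{a<..b}|lebesgue. \<bar>g t\<bar>) \<le> (LINT t:{a<..b}|lebesgue. B * t powr (- \<beta>))"
  proof (intro set_integral_mono_AE set_integrable_abs locally_integrable_Ioc[OF g])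
    show "set_integrable lebesgue {a<..b} (\<lambda>t. B * t powr (- \<beta>))" using P(1) by simp
    show "AE t\<in>{a<..b} in lebesgue. \<bar>g t\<bar> \<le> B * t powr (- \<beta>)"
      using ae by eventually_elim (use assms in auto)
  qed (use assms in auto)
  also have "\<dots> \<le> B * (a powr (1 - \<beta>) / (\<beta> - 1))"
    unfolding set_integral_mult_right by (intro mult_left_mono P(2) assms)
  finally show ?thesis by simp
qed

text \<open>Otherwise |v| > D A almost everywhere on (R/2,R), where the weight is at least c
  (R/2)^m, and the integral over this interval of length R/2 would exceed A^p. The point must avoid
  N because increments of v are controlled only off N.\<close>

lemma exists_small_value:
  fixes R p A c D :: real and m :: nat
  assumes "0 < R" "0 < p" "0 < A" "0 < c" "0 < D"
    and D: "1 < D powr p * (c * (R / 2) ^ m * (R / 2))"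
    and w: "\<And>t. t \<in> {0<..<R} \<Longrightarrow> c * t ^ m \<le> w t"
    and int: "set_integrable lebesgue {0<..<R} (\<lambda>t. \<bar>v t\<bar> powr p * w t)"
    and le: "(LINT t:{0<..<R}|lebesgue. \<bar>v t\<bar> powr p * w t) \<le> A powr p"
    and N: "negligible N"
  obtains s where "s \<in> {R/2<..<R} - N" "\<bar>v s\<bar> \<le> D * A"
proof (rule ccontr)
  assume "\<not> thesis"
  then have gt: "D * A < \<bar>v s\<bar>" if "s \<in> {R/2<..<R} - N" for s
    using that \<open>\<And>s. s \<in> {R/2<..<R} - N \<Longrightarrow> \<bar>v s\<bar> \<le> D * A \<Longrightarrow> thesis\<close> by (meson not_le)
  have sub: "{R/2<..<R} \<subseteq> {0<..<R}" using assms by auto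
  have w0: "0 \<le> w t" if "t \<in> {0<..<R}" for t
  proof -
    have "0 \<le> c * t ^ m" using that \<open>0 < c\<close> by simp
    then show ?thesis using w[OF that] by linarith
  qed
  define L where "L = (D * A) powr p * (c * (R / 2) ^ m)"
  have "A powr p < L * (R / 2)"
  proof -
    have "A powr p * 1 < A powr p * (D powr p * (c * (R / 2) ^ m * (R / 2)))"
      using D assms by (intro mult_strict_left_mono) auto
    then show ?thesis using assms by (simp add: L_def powr_mult ac_simps)
  qed
  also have "L * (R / 2) = (LINT t:{R/2<..<R}|lebesgue. L)"
    using assms by (subst set_integral_const) auto
  also have "\<dots> \<le> (LINT t:{R/2<..<R}|lebesgue. \<bar>v t\<bar> powr p * w t)"
  proof (rule set_integral_mono_AE)
    show "set_integrable lebesgue {R/2<..<R} (\<lambda>t. \<bar>v t\<bar> powr p * w t)"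
      by (rule set_integrable_subset[OF int _ sub]) auto
    show "set_integrable lebesgue {R/2<..<R} (\<lambda>t. L)"
      by (rule absolutely_integrable_on_const) auto
    have "AE t in lebesgue. t \<notin> N"
      using N by (auto simp: negligible_iff_null_sets intro: AE_not_in)
    then show "AE t\<in>{R/2<..<R} in lebesgue. L \<le> \<bar>v t\<bar> powr p * w t"
    proof eventually_elim
      case (elim t)
      show ?case
      proof
        assume t: "t \<in> {R/2<..<R}"
        then have "c * (R / 2) ^ m \<le> c * t ^ m"
          using assms by (intro mult_left_mono power_mono) auto
        also have "\<dots> \<le> w t" using w t sub by blast
        finally have "c * (R / 2) ^ m \<le> w t" .
        then show "L \<le> \<bar>v t\<bar> powr p * w t"
          unfolding L_def using gt[of t] t elim assms
          by (intro mult_mono powr_mono2) auto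
      qed
    qed
  qed
  also have "\<dots> \<le> A powr p"
    by (rule order_trans[OF set_integral_mono_set_nonneg[OF int _ sub] le]) (simp_all add: w0)
  finally show False by simp
qed

text \<open>The value at t is compared with that at the point s of
  \<open>exists_small_value\<close>; the tail bound controls the increment in whichever order t and
  s lie.\<close>

lemma pointwise_bound:
  fixes R p A c D K \<beta> :: real and m :: nat
  assumes "0 < R" "0 < p" "0 < A" "0 < c" "0 < D" "0 \<le> K" "0 \<le> \<beta>"
    and D: "1 < D powr p * (c * (R / 2) ^ m * (R / 2))"
    and w: "\<And>t. t \<in> {0<..<R} \<Longrightarrow> c * t ^ m \<le> w t"
    and int: "set_integrable lebesgue {0<..<R} (\<lambda>t. \<bar>v t\<bar> powr p * w t)"
    and le: "(LINT t:{0<..<R}|lebesgue. \<bar>v t\<bar> powr p * w t) \<le> A powr p"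
    and N: "negligible N"
    and incr: "\<And>a b. a \<in> {0<..<R} - N \<Longrightarrow> b \<in> {0<..<R} - N \<Longrightarrow> a < b \<Longrightarrow>
      v b - v a = (LINT t:{a<..b}|lebesgue. g t)"
    and g: "locally_integrable R g"
    and tail: "\<And>a b. 0 < a \<Longrightarrow> a < b \<Longrightarrow> b < R \<Longrightarrow>
      (LINT t:{a<..b}|lebesgue. \<bar>g t\<bar>) \<le> A * K * a powr (- \<beta>)"
  shows "AE t in lebesgue. t \<in> {0<..<R} \<longrightarrow>
    \<bar>v t\<bar> \<le> A * (D * R powr \<beta> + K * 2 powr \<beta>) * t powr (- \<beta>)"
proof -
  obtain s where s: "s \<in> {R/2<..<R} - N" "\<bar>v s\<bar> \<le> D * A"
    using exists_small_value[OF assms(1-5) D w int le N] by blast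
  have s': "s \<in> {0<..<R} - N" using s \<open>0 < R\<close> by auto
  have bound: "\<bar>v t\<bar> \<le> A * (D * R powr \<beta> + K * 2 powr \<beta>) * t powr (- \<beta>)"
    if t: "t \<in> {0<..<R} - N" for t
  proof -
    \<comment> \<open>In both orders the left endpoint is at least t / 2: it is t itself, or s > R/2
      > t/2. This is the origin of \<open>2 powr \<beta>\<close>.\<close>
    have diff: "\<bar>v b - v a\<bar> \<le> A * K * (t / 2) powr (- \<beta>)"
      if "a < b" "t / 2 \<le> a" "a \<in> {0<..<R} - N" "b \<in> {0<..<R} - N" for a b
    proof -
      have "\<bar>v b - v a\<bar> \<le> (LINT t:{a<..b}|lebesgue. \<bar>g t\<bar>)"
        unfolding incr[OF that(3,4,1)]
        using set_integral_norm_bound[OF locally_integrable_Ioc[OF g, of a b]] that by simp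
      also have "\<dots> \<le> A * K * a powr (- \<beta>)" using tail that by auto
      also have "\<dots> \<le> A * K * (t / 2) powr (- \<beta>)"
        using assms t that by (intro mult_left_mono powr_mono2') auto
      finally show ?thesis .
    qed
    have "\<bar>v t - v s\<bar> \<le> A * K * (t / 2) powr (- \<beta>)"
    proof (cases t s rule: linorder_cases)
      case less
      show ?thesis using diff[OF less _ t s'] t by (simp add: abs_minus_commute)
    next
      case equal
      then show ?thesis using assms by simp
    next
      case greater
      show ?thesis using diff[OF greater _ s' t] t s by simp
    qed
    then have "\<bar>v t\<bar> \<le> A * D * 1 + A * K * (t / 2) powr (- \<beta>)"
      using s(2) unfolding mult.commute[of D] by linarith
    also have "\<dots> \<le> A * D * (R powr \<beta> * t powr (- \<beta>)) + A * K * (t / 2) powr (- \<beta>)"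
    proof -
      \<comment> \<open>The constant part is absorbed into the power of t, since t < R and \<beta>
        is nonnegative.\<close>
      have "1 = R powr \<beta> * R powr (- \<beta>)" using assms by (simp add: powr_add[symmetric])
      also have "\<dots> \<le> R powr \<beta> * t powr (- \<beta>)"
        using assms t by (intro mult_left_mono powr_mono2') auto
      finally show ?thesis using assms by (intro add_right_mono mult_left_mono) auto
    qed
    also have "(t / 2) powr (- \<beta>) = 2 powr \<beta> * t powr (- \<beta>)"
      using t by (simp add: powr_divide powr_minus_divide)
    finally show ?thesis by (simp add: algebra_simps)
  qed
  have "AE t in lebesgue. t \<notin> N"
    using N by (auto simp: negligible_iff_null_sets intro: AE_not_in)
  then show ?thesis by eventually_elim (use bound in auto)
qed

section \<open>Continuous representatives and the pointwise bound\<close>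

lemma has_weak_deriv_weak_deriv:
  "\<exists>g. has_weak_deriv R j v g \<Longrightarrow> has_weak_deriv R j v (weak_deriv R j v)"
  unfolding weak_deriv_def by (rule someI_ex[of "has_weak_deriv R j v"])

text \<open>Off N, v is its value at a base point plus the integral of g from there, and this
  primitive is continuous on all of (0,R). The base point is taken off N so that the increment
  formula applies to it.\<close>

lemma continuous_representative_exists:
  assumes "0 < R" and g: "locally_integrable R g" and N: "negligible N"
    and incr: "\<And>a b. a \<in> {0<..<R} - N \<Longrightarrow> b \<in> {0<..<R} - N \<Longrightarrow> a < b \<Longrightarrow>
      v b - v a = (LINT t:{a<..b}|lebesgue. g t)"
  shows "\<exists>u. continuous_on {0<..<R} u \<and> (AE t in lebesgue. t \<in> {0<..<R} \<longrightarrow> u t = v t)"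
proof -
  have "\<not> {0<..<R} \<subseteq> N"
    using N open_not_negligible[of "{0<..<R}"] \<open>0 < R\<close> negligible_subset by auto
  then obtain a where a: "a \<in> {0<..<R} - N" by blast
  define u where "u t = v a + (if a \<le> t then integral {a..t} g else - integral {t..a} g)" for t
  have gint: "g integrable_on {c..d}" if "0 < c" "d < R" for c d
  proof -
    have "{c..d} \<subseteq> {0<..<R}" using that by auto
    then show ?thesis
      using g compact_Icc set_lebesgue_integral_eq_integral(1) unfolding locally_integrable_def by blast
  qed
  \<comment> \<open>A lower limit c to the left of both a and t merges the two branches, so
    continuity of one indefinite integral also covers t = a.\<close>
  have u_eq: "u t = v a - integral {c..a} g + integral {c..t} g"
    if "0 < c" "c \<le> a" "c \<le> t" "t < R" for c t
  proof (cases "a \<le> t")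
    case True
    then show ?thesis
      using Henstock_Kurzweil_Integration.integral_combine[OF that(2) True gint] that
      by (simp add: u_def)
  next
    case False
    then have "t \<le> a" by simp
    then show ?thesis
      using Henstock_Kurzweil_Integration.integral_combine[OF that(3) \<open>t \<le> a\<close> gint] that a False
      by (simp add: u_def)
  qed
  have "isCont u t" if t: "t \<in> {0<..<R}" for t
  proof -
    define c where "c = min a t / 2"
    define d where "d = (t + R) / 2"
    have cd: "0 < c" "c \<le> a" "c < t" "t < d" "d < R" using a t by (auto simp: c_def d_def)
    have "continuous_on {c..d} (\<lambda>t. v a - integral {c..a} g + integral {c..t} g)"
      using cd gint by (intro continuous_intros indefinite_integral_continuous_1) auto
    then have "continuous_on {c<..<d} (\<lambda>t. v a - integral {c..a} g + integral {c..t} g)"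
      by (rule continuous_on_subset) auto
    then have "continuous_on {c<..<d} u"
      using cd by (subst continuous_on_cong[OF refl u_eq]) auto
    then show ?thesis using cd by (simp add: continuous_on_eq_continuous_at)
  qed
  then have "continuous_on {0<..<R} u" by (simp add: continuous_at_imp_continuous_on)
  moreover have eq: "u t = v t" if t: "t \<in> {0<..<R} - N" for t
  proof -
    have LINT_eq: "(LINT t:{x<..y}|lebesgue. g t) = integral {x..y} g" if "0 < x" "y < R" for x y
    proof -
      have "(LINT t:{x<..y}|lebesgue. g t) = integral {x<..y} g"
        by (rule set_lebesgue_integral_eq_integral(2)[OF locally_integrable_Ioc[OF g that]])
      also have "\<dots> = integral {x..y} g"
        by (rule integral_spike_set) (auto intro: negligible_subset[of "{x}"])
      finally show ?thesis .
    qed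
    show ?thesis
    proof (cases a t rule: linorder_cases)
      case less
      then show ?thesis using incr[OF a t less] LINT_eq[of a t] a t by (simp add: u_def)
    next
      case equal
      then show ?thesis by (simp add: u_def)
    next
      case greater
      then show ?thesis using incr[OF t a greater] LINT_eq[of t a] a t by (simp add: u_def)
    qed
  qed
  have "AE t in lebesgue. t \<notin> N"
    using N by (auto simp: negligible_iff_null_sets intro: AE_not_in)
  then have "AE t in lebesgue. t \<in> {0<..<R} \<longrightarrow> u t = v t"
    by eventually_elim (use eq in auto)
  ultimately show ?thesis by blast
qed

text \<open>The set where the inequality fails is open, and a nonempty open set is not
  negligible.\<close>

lemma continuous_le_if_AE_le:
  fixes f g :: "real \<Rightarrow> real"
  assumes "open S" "continuous_on S f" "continuous_on S g"
    and "AE t in lebesgue. t \<in> S \<longrightarrow> f t \<le> g t" and "x \<in> S"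
  shows "f x \<le> g x"
proof (rule ccontr)
  assume "\<not> f x \<le> g x"
  let ?T = "{t \<in> S. 0 < f t - g t}"
  have "open ?T"
    using continuous_open_preimage[OF continuous_on_diff[OF assms(2,3)] assms(1), of "{0<..}"]
    by (simp add: vimage_def Int_def)
  moreover have "AE t in lebesgue. t \<notin> ?T" using assms(4) by eventually_elim auto
  then have "negligible ?T"
    using \<open>open ?T\<close> by (simp add: negligible_iff_null_sets AE_iff_null_sets)
  moreover have "x \<in> ?T" using \<open>\<not> f x \<le> g x\<close> \<open>x \<in> S\<close> by simp
  ultimately show False using open_not_negligible by blast
qed

text \<open>The induction counts integrations downward from order k; each raises the exponent of t
  by 1. \<open>K\<close> is fixed before \<open>A\<close> and \<open>v\<close>, which makes the
  final constant uniform.\<close>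

lemma weak_deriv_pointwise_bound:
  fixes R p c :: real and m k i :: nat and w :: "real \<Rightarrow> real"
  assumes "0 < R" "1 \<le> p" "0 < c" and kp: "real k * p < real (Suc m)"
    and w: "\<And>t. t \<in> {0<..<R} \<Longrightarrow> c * t ^ m \<le> w t"
    and "1 \<le> i" "i \<le> k"
  shows "\<exists>K\<ge>0. \<forall>A v. 0 < A \<longrightarrow> v \<in> weighted_sobolev k p R w \<longrightarrow>
    (\<forall>j\<le>k. (LINT t:{0<..<R}|lebesgue. \<bar>weak_deriv R j v t\<bar> powr p * w t) \<le> A powr p) \<longrightarrow>
    (AE t in lebesgue. t \<in> {0<..<R} \<longrightarrow>
      \<bar>weak_deriv R (k - i) v t\<bar> \<le> A * K * t powr (- (real (Suc m) / p - real i)))"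
  using \<open>1 \<le> i\<close> \<open>i \<le> k\<close>
proof (induction i rule: nat_induct_at_least)
  obtain h \<rho> M where "smooth_step h \<rho> M" using ex_smooth_step by blast
  then interpret smooth_step h \<rho> M .
  define n where "n = real (Suc m)"
  define q where "q = c * (R / 2) ^ m * (R / 2)"
  \<comment> \<open>Chosen so that D^p q = 2, above the required 1.\<close>
  define D where "D = (2 / q) powr (1 / p)"
  have "0 < q" using assms by (simp add: q_def)
  then have D0: "0 < D" by (simp add: D_def)
  have D: "1 < D powr p * (c * (R / 2) ^ m * (R / 2))"
    unfolding q_def[symmetric] using \<open>0 < q\<close> \<open>1 \<le> p\<close> by (simp add: D_def powr_powr)
  have exponent: "0 < n / p - real i" if "i \<le> k" for i
  proof -
    have "real i * p \<le> real k * p" using that \<open>1 \<le> p\<close> by (intro mult_right_mono) auto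
    then have "real i * p < n" using kp by (simp add: n_def)
    then show ?thesis using \<open>1 \<le> p\<close> by (simp add: pos_less_divide_eq)
  qed
  \<comment> \<open>Common to base and induction step: a tail bound at order j + 1 becomes a
    pointwise bound at order j. Only the origin of the tail bound differs.\<close>
  have transfer: "AE t in lebesgue. t \<in> {0<..<R} \<longrightarrow>
      \<bar>weak_deriv R j v t\<bar> \<le> A * (D * R powr \<beta> + K * 2 powr \<beta>) * t powr (- \<beta>)"
    if "0 < A" "v \<in> weighted_sobolev k p R w" "j < k" "0 \<le> K" "0 \<le> \<beta>"
      and le: "\<forall>j\<le>k. (LINT t:{0<..<R}|lebesgue. \<bar>weak_deriv R j v t\<bar> powr p * w t) \<le> A powr p"
      and tail: "\<And>a b. 0 < a \<Longrightarrow> a < b \<Longrightarrow> b < R \<Longrightarrow>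
        (LINT t:{a<..b}|lebesgue. \<bar>weak_deriv R (Suc j) v t\<bar>) \<le> A * K * a powr (- \<beta>)"
    for A v j K \<beta>
  proof -
    have deriv: "has_weak_deriv R 1 (weak_deriv R j v) (weak_deriv R (Suc j) v)"
      using that(2,3) unfolding weighted_sobolev_def
      by (intro has_weak_deriv_step[of R j v] has_weak_deriv_weak_deriv) auto
    then have g: "locally_integrable R (weak_deriv R (Suc j) v)"
      by (simp add: has_weak_deriv_def)
    obtain N where N: "negligible N" and incr:
      "\<And>a b. a \<in> {0<..<R} - N \<Longrightarrow> b \<in> {0<..<R} - N \<Longrightarrow> a < b \<Longrightarrow>
        weak_deriv R j v b - weak_deriv R j v a = (LINT t:{a<..b}|lebesgue. weak_deriv R (Suc j) v t)"
      by (rule weak_deriv_increment[OF deriv]) blast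
    show ?thesis
      by (rule pointwise_bound[OF \<open>0 < R\<close> _ \<open>0 < A\<close> \<open>0 < c\<close> D0 \<open>0 \<le> K\<close> \<open>0 \<le> \<beta>\<close> D w _ _ N incr g tail])
         (use assms that in \<open>auto simp: weighted_sobolev_def\<close>)
  qed
  {
    case base
    define K where "K = 1 / (n / p - 1) + 1 / c"
    have "0 \<le> K" using exponent[of 1] base \<open>0 < c\<close> by (auto simp: K_def)
    have "AE t in lebesgue. t \<in> {0<..<R} \<longrightarrow> \<bar>weak_deriv R (k - 1) v t\<bar> \<le>
        A * (D * R powr (n / p - 1) + K * 2 powr (n / p - 1)) * t powr (- (n / p - 1))"
      if "0 < A" and v: "v \<in> weighted_sobolev k p R w"
        and le: "\<forall>j\<le>k. (LINT t:{0<..<R}|lebesgue. \<bar>weak_deriv R j v t\<bar> powr p * w t) \<le> A powr p"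
      for A v
    proof (rule transfer[OF that(1,2) _ \<open>0 \<le> K\<close> _ le])
      show "k - 1 < k" using base by simp
      show "0 \<le> n / p - 1" using exponent[of 1] base by simp
      fix a b :: real assume ab: "0 < a" "a < b" "b < R"
      have "has_weak_deriv R k v (weak_deriv R k v)"
        using v by (intro has_weak_deriv_weak_deriv) (auto simp: weighted_sobolev_def)
      then have "locally_integrable R (weak_deriv R k v)" by (simp add: has_weak_deriv_def)
      moreover have "p < real (Suc m)" using exponent[of 1] base \<open>1 \<le> p\<close> by (simp add: n_def field_simps)
      ultimately have "(LINT t:{a<..b}|lebesgue. \<bar>weak_deriv R k v t\<bar>) \<le> A * K * a powr (- (n / p - 1))"
        unfolding K_def n_def
        using assms ab v le \<open>0 < A\<close>
        by (intro Lp_tail_integral[where w = w and R = R]) (auto simp: weighted_sobolev_def)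
      then show "(LINT t:{a<..b}|lebesgue. \<bar>weak_deriv R (Suc (k - 1)) v t\<bar>) \<le> A * K * a powr (- (n / p - 1))"
        using base by simp
    qed
    moreover have "0 \<le> D * R powr (n / p - 1) + K * 2 powr (n / p - 1)"
      using D0 \<open>0 \<le> K\<close> by simp
    ultimately show ?case unfolding n_def of_nat_1 by blast
  next
    case (Suc i)
    then obtain K where "0 \<le> K" and K: "\<And>A v. 0 < A \<Longrightarrow> v \<in> weighted_sobolev k p R w \<Longrightarrow>
      \<forall>j\<le>k. (LINT t:{0<..<R}|lebesgue. \<bar>weak_deriv R j v t\<bar> powr p * w t) \<le> A powr p \<Longrightarrow>
      AE t in lebesgue. t \<in> {0<..<R} \<longrightarrow>
        \<bar>weak_deriv R (k - i) v t\<bar> \<le> A * K * t powr (- (n / p - real i))"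
      unfolding n_def by (meson Suc_leD)
    \<comment> \<open>The known bound has exponent -(\<beta> + 1); its integration divides by
      \<beta>, hence the new tail constant K / \<beta>.\<close>
    define \<beta> where "\<beta> = n / p - real (Suc i)"
    have \<beta>: "0 < \<beta>" "n / p - real i = \<beta> + 1" using exponent[OF Suc.prems] by (simp_all add: \<beta>_def)
    have "AE t in lebesgue. t \<in> {0<..<R} \<longrightarrow> \<bar>weak_deriv R (k - Suc i) v t\<bar> \<le>
        A * (D * R powr \<beta> + K / \<beta> * 2 powr \<beta>) * t powr (- \<beta>)"
      if "0 < A" and v: "v \<in> weighted_sobolev k p R w"
        and le: "\<forall>j\<le>k. (LINT t:{0<..<R}|lebesgue. \<bar>weak_deriv R j v t\<bar> powr p * w t) \<le> A powr p"
      for A v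
    proof (rule transfer[OF that(1,2) _ _ _ le])
      show "k - Suc i < k" using Suc.prems by simp
      show "0 \<le> K / \<beta>" "0 \<le> \<beta>" using \<beta> \<open>0 \<le> K\<close> by auto
      fix a b :: real assume ab: "0 < a" "a < b" "b < R"
      have "has_weak_deriv R (k - i) v (weak_deriv R (k - i) v)"
        using v by (intro has_weak_deriv_weak_deriv) (auto simp: weighted_sobolev_def)
      then have g: "locally_integrable R (weak_deriv R (k - i) v)" by (simp add: has_weak_deriv_def)
      have "(LINT t:{a<..b}|lebesgue. \<bar>weak_deriv R (k - i) v t\<bar>) \<le>
          A * K / (\<beta> + 1 - 1) * a powr (- (\<beta> + 1 - 1))"
        using K[OF that] \<beta> ab \<open>0 < A\<close> \<open>0 \<le> K\<close>
        by (intro pointwise_tail_integral[OF _ _ _ _ _ g]) auto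
      moreover have "Suc (k - Suc i) = k - i" using Suc.prems by simp
      ultimately show "(LINT t:{a<..b}|lebesgue. \<bar>weak_deriv R (Suc (k - Suc i)) v t\<bar>) \<le>
          A * (K / \<beta>) * a powr (- \<beta>)"
        by simp
    qed
    moreover have "0 \<le> D * R powr \<beta> + K / \<beta> * 2 powr \<beta>"
      using D0 \<open>0 \<le> K\<close> \<beta> by simp
    ultimately show ?case unfolding \<beta>_def n_def by blast
  }
qed

text \<open>The exponent of t is nonpositive, so passing from t to \<phi> takes the upper bound
  \<phi> \<le> C t; the lower bound serves for the weight.\<close>

lemma powr_weight_comparison:
  fixes t x C \<beta> :: real
  assumes "0 < t" "0 < x" "x \<le> C * t" "0 \<le> \<beta>"
  shows "t powr (- \<beta>) \<le> C powr \<beta> * (1 / x powr \<beta>)"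
proof -
  have "0 < C * t" using assms by linarith
  then have "0 < C" using assms by (simp add: zero_less_mult_iff)
  have "x powr \<beta> \<le> (C * t) powr \<beta>" using assms by (intro powr_mono2) auto
  then have "x powr \<beta> \<le> C powr \<beta> * t powr \<beta>" using assms \<open>0 < C\<close> by (simp add: powr_mult)
  then show ?thesis using assms by (simp add: powr_minus field_simps)
qed

theorem proposition5p2:
  fixes R p :: real and N k :: nat and \<phi> :: "real \<Rightarrow> real"
  assumes "0 < R" and "2 \<le> N" and "1 \<le> k" and "1 \<le> p"
    and "smooth_on {0..<R} \<phi>"
    and "\<forall>t\<in>{0..<R}. 0 \<le> \<phi> t"
    and "\<forall>t\<in>{0<..<R}. 0 < \<phi> t"
    and "iter_deriv_on {0..<R} 1 \<phi> 0 = 1"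
    and "\<forall>i. even i \<longrightarrow> iter_deriv_on {0..<R} i \<phi> 0 = 0"
    and "0 < Liminf (at_left R) (\<lambda>r. ereal (\<phi> r))"
    and "Liminf (at_left R) (\<lambda>r. ereal (\<phi> r)) \<le> Limsup (at_left R) (\<lambda>r. ereal (\<phi> r))"
    and "Limsup (at_left R) (\<lambda>r. ereal (\<phi> r)) < \<infinity>"
    and "real N > real k * p"
  shows "\<exists>C>0. \<forall>v\<in>weighted_sobolev k p R (\<lambda>t. \<phi> t ^ (N - 1)). \<forall>t\<in>{0<..<R}.
    \<bar>cont_rep R v t\<bar> \<le> C * (1 / \<phi> t powr ((real N - real k * p) / p)) *
      weighted_sobolev_norm k p R (\<lambda>t. \<phi> t ^ (N - 1)) v"
proof -
  define w where "w t = \<phi> t ^ (N - 1)" for t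
  define \<beta> where "\<beta> = (real N - real k * p) / p"
  have "0 < \<beta>" using assms(4,13) by (simp add: \<beta>_def)
  have "\<phi> 0 = 0" using assms(9) by (metis even_zero iter_deriv_on.simps(1))
  then obtain c C where "0 < c" "0 < C"
    and lower: "\<And>t. t \<in> {0<..<R} \<Longrightarrow> c * t \<le> \<phi> t"
    and upper: "\<And>t. t \<in> {0<..<R} \<Longrightarrow> \<phi> t \<le> C * t"
    using linear_bounds[OF assms(1,5,7) _ assms(8,10,12)] by blast
  have w: "c ^ (N - 1) * t ^ (N - 1) \<le> w t" if "t \<in> {0<..<R}" for t
    unfolding w_def power_mult_distrib[symmetric]
    using lower[OF that] that \<open>0 < c\<close> by (intro power_mono) auto
  have w0: "0 \<le> w t" if "t \<in> {0<..<R}" for t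
    using assms(7) that by (simp add: w_def less_imp_le)
  have N: "real (Suc (N - 1)) = real N" using assms(2) by simp
  \<comment> \<open>Taken with i = k and m = N - 1, so that order 0 is reached; obtained before v is
    fixed.\<close>
  obtain K where "0 \<le> K" and K: "\<And>A v. 0 < A \<Longrightarrow> v \<in> weighted_sobolev k p R w \<Longrightarrow>
    \<forall>j\<le>k. (LINT t:{0<..<R}|lebesgue. \<bar>weak_deriv R j v t\<bar> powr p * w t) \<le> A powr p \<Longrightarrow>
    AE t in lebesgue. t \<in> {0<..<R} \<longrightarrow>
      \<bar>weak_deriv R (k - k) v t\<bar> \<le> A * K * t powr (- (real (Suc (N - 1)) / p - real k))"
    using weak_deriv_pointwise_bound[of R p "c ^ (N - 1)" k "N - 1" w k] assms(1,3,4,13) \<open>0 < c\<close> w N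
    by auto
  have exponent: "real (Suc (N - 1)) / p - real k = \<beta>"
    using assms(4) N by (simp add: \<beta>_def field_simps)
  \<comment> \<open>K may be 0 while the constant must be positive, hence K + 1.\<close>
  define L where "L = (K + 1) * C powr \<beta>"
  have "\<bar>cont_rep R v t\<bar> \<le> L * (1 / \<phi> t powr \<beta>) * weighted_sobolev_norm k p R w v"
    if v: "v \<in> weighted_sobolev k p R w" and t: "t \<in> {0<..<R}" for v t
  proof -
    obtain h \<rho> M where "smooth_step h \<rho> M" using ex_smooth_step by blast
    then interpret smooth_step h \<rho> M .
    have deriv: "has_weak_deriv R j v (weak_deriv R j v)" if "j \<le> k" for j
      using v that by (intro has_weak_deriv_weak_deriv) (auto simp: weighted_sobolev_def)
    have "\<exists>u. continuous_on {0<..<R} u \<and> (AE t in lebesgue. t \<in> {0<..<R} \<longrightarrow> u t = v t)"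
    proof (rule weak_deriv_increment[OF deriv[OF assms(3)]])
      fix N' assume "negligible N'" "\<And>a b. a \<in> {0<..<R} - N' \<Longrightarrow> b \<in> {0<..<R} - N' \<Longrightarrow> a < b \<Longrightarrow>
        v b - v a = (LINT t:{a<..b}|lebesgue. weak_deriv R 1 v t)"
      moreover have "locally_integrable R (weak_deriv R 1 v)"
        using deriv[OF assms(3)] by (simp add: has_weak_deriv_def)
      ultimately show ?thesis by (intro continuous_representative_exists[OF assms(1)])
    qed
    then have rep: "continuous_on {0<..<R} (cont_rep R v) \<and>
        (AE t in lebesgue. t \<in> {0<..<R} \<longrightarrow> cont_rep R v t = v t)"
      unfolding cont_rep_def by (rule someI_ex)
    have v_eq: "AE t in lebesgue. t \<in> {0<..<R} \<longrightarrow> v t = weak_deriv R 0 v t"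
      by (rule weak_deriv_0_AE_eq[OF deriv]) simp
    define S where "S = (\<Sum>j\<le>k. LINT t:{0<..<R}|lebesgue. \<bar>weak_deriv R j v t\<bar> powr p * w t)"
    have summand0: "0 \<le> (LINT t:{0<..<R}|lebesgue. \<bar>weak_deriv R j v t\<bar> powr p * w t)" for j
      unfolding set_lebesgue_integral_def
      by (intro Bochner_Integration.integral_nonneg) (auto simp: indicator_def w0)
    have norm_eq: "weighted_sobolev_norm k p R w v = S powr (1 / p)"
      by (simp add: weighted_sobolev_norm_def S_def)
    have "0 \<le> S" unfolding S_def by (intro sum_nonneg summand0)
    have "0 < \<phi> t" using assms(7) t by blast
    then have pos: "0 < L * (1 / \<phi> t powr \<beta>)" using \<open>0 \<le> K\<close> \<open>0 < C\<close> by (simp add: L_def)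
    \<comment> \<open>The bound is proved for every A above the norm, with A alone on the right, so
      that \<open>dense_ge\<close> can pass to the norm itself, even when it is 0.\<close>
    have "\<bar>cont_rep R v t\<bar> / (L * (1 / \<phi> t powr \<beta>)) \<le> A" if A: "S powr (1 / p) < A" for A
    proof -
      have "0 < A" using A powr_ge_zero[of S "1 / p"] by linarith
      have "S = (S powr (1 / p)) powr p" using \<open>0 \<le> S\<close> assms(4) by (simp add: powr_powr)
      also have "\<dots> \<le> A powr p" using A assms(4) by (intro powr_mono2) auto
      finally have "S \<le> A powr p" .
      have "\<forall>j\<le>k. (LINT t:{0<..<R}|lebesgue. \<bar>weak_deriv R j v t\<bar> powr p * w t) \<le> A powr p"
      proof (intro allI impI)
        fix j assume "j \<le> k"
        then have "(LINT t:{0<..<R}|lebesgue. \<bar>weak_deriv R j v t\<bar> powr p * w t) \<le> S"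
          unfolding S_def using summand0 by (intro member_le_sum) auto
        then show "(LINT t:{0<..<R}|lebesgue. \<bar>weak_deriv R j v t\<bar> powr p * w t) \<le> A powr p"
          using \<open>S \<le> A powr p\<close> by linarith
      qed
      from K[OF \<open>0 < A\<close> v this]
      have "AE t in lebesgue. t \<in> {0<..<R} \<longrightarrow> \<bar>weak_deriv R 0 v t\<bar> \<le> A * K * t powr (- \<beta>)"
        unfolding exponent by simp
      \<comment> \<open>\<open>cont_rep R v\<close>, v and \<open>weak_deriv R 0 v\<close> agree
        only almost everywhere; continuity then gives the bound at the given t.\<close>
      with v_eq rep[THEN conjunct2]
      have "AE t in lebesgue. t \<in> {0<..<R} \<longrightarrow> \<bar>cont_rep R v t\<bar> \<le> A * K * t powr (- \<beta>)"
        by eventually_elim auto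
      then have "\<bar>cont_rep R v t\<bar> \<le> A * K * t powr (- \<beta>)"
        using rep t by (intro continuous_le_if_AE_le[of "{0<..<R}"] continuous_intros) auto
      also have "\<dots> \<le> A * (K + 1) * (C powr \<beta> * (1 / \<phi> t powr \<beta>))"
        using \<open>0 < A\<close> \<open>0 \<le> K\<close> \<open>0 < \<beta>\<close> t assms(7) upper[OF t]
        by (intro mult_mono powr_weight_comparison) auto
      also have "\<dots> = A * (L * (1 / \<phi> t powr \<beta>))" by (simp add: L_def)
      finally show ?thesis
        by (subst pos_divide_le_eq[OF pos])
    qed
    then have "\<bar>cont_rep R v t\<bar> / (L * (1 / \<phi> t powr \<beta>)) \<le> S powr (1 / p)"
      by (rule dense_ge)
    then show ?thesis
      unfolding norm_eq
      by (subst (asm) pos_divide_le_eq[OF pos]) (simp only: mult.commute)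
  qed
  moreover have "0 < L" using \<open>0 \<le> K\<close> \<open>0 < C\<close> by (simp add: L_def)
  ultimately show ?thesis unfolding w_def \<beta>_def by blast
qed

end
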